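(* For all integers $1\le k\le n$, \[h_{\Delta(\widehat{\mathcal{L}}(U_{k,n}))}(x)=\sum_{i=1}^k\binom{n-i-1}{k-i}\,\underline{H}_{U_{i,n}}(x),\] with the convention $\binom{-1}{0}=1$.
   Context: $U_{k,n}$ is the uniform matroid of rank $k$ on $[n]$ (bases: all $k$-subsets). For a loopless matroid $M$ of rank $k$ on $E$, its Bergman complex $\Delta(\widehat{\mathcal{L}}(M))$ is the simplicial complex whose faces are the chains of flats $F_1\subsetneq\cdots\subsetneq F_r$ with $\varnothing\ne F_i\ne E$ (including the empty chain); it has dimension $k-2$. With $f_{i-1}$ the number of faces with $i$ elements ($f_{-1}=1$), its $f$-polynomial is $f(x)=\sum_{i=0}^{k-1}f_{i-1}x^{k-1-i}$ and its $h$-polynomial is $h_{\Delta(\widehat{\mathcal{L}}(M))}(x)=f(x-1)$. Chow ring: $\underline{\mathrm{CH}}(M)=\mathbb{Q}[x_F: F\in\mathcal{L}(M)\setminus\{\varnothing,E\}]/(I+J)$, $I$ generated by $x_{F_1}x_{F_2}$ for incomparable flats $F_1,F_2$, $J$ by $\sum_{F\ni i}x_F-\sum_{F\ni j}x_F$ for $i,j\in E$; variables of degree $1$; $\underline{H}_M(x)=\sum_j\dim_{\mathbb{Q}}\underline{\mathrm{CH}}^j(M)x^j$. *)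

theory Defs
  imports "HOL-Library.Poly_Mapping" "HOL-Computational_Algebra.Polynomial"
          "HOL-Computational_Algebra.Polynomial_FPS"
begin

text \<open>A matroid on a finite ground set E is given by its set of bases Bs.\<close>

definition uniform_bases :: "nat \<Rightarrow> nat \<Rightarrow> nat set set" where
  "uniform_bases k n = {B. B \<subseteq> {1..n} \<and> card B = k}"

definition mrank :: "'a set set \<Rightarrow> 'a set \<Rightarrow> nat" where
  "mrank Bs A = Max ((\<lambda>B. card (A \<inter> B)) ` Bs)"

definition flats :: "'a set \<Rightarrow> 'a set set \<Rightarrow> 'a set set" where
  "flats E Bs = {F. F \<subseteq> E \<and> (\<forall>e\<in>E - F. mrank Bs F < mrank Bs (insert e F))}"

definition proper_flats :: "'a set \<Rightarrow> 'a set set \<Rightarrow> 'a set set" where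
  "proper_flats E Bs = flats E Bs - {{}, E}"

definition is_chain :: "'a set set \<Rightarrow> bool" where
  "is_chain C \<longleftrightarrow> (\<forall>F\<in>C. \<forall>G\<in>C. F \<subseteq> G \<or> G \<subseteq> F)"

text \<open>Number of faces (chains of proper nonempty flats) with exactly i elements,
  i.e. f_{i-1}.\<close>
definition bergman_faces :: "'a set \<Rightarrow> 'a set set \<Rightarrow> nat \<Rightarrow> nat" where
  "bergman_faces E Bs i =
     card {C. C \<subseteq> proper_flats E Bs \<and> finite C \<and> is_chain C \<and> card C = i}"

definition bergman_f_poly :: "'a set \<Rightarrow> 'a set set \<Rightarrow> rat poly" where
  "bergman_f_poly E Bs =
     (let k = mrank Bs E in
      \<Sum>i<k. monom (of_nat (bergman_faces E Bs i)) (k - 1 - i))"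

definition bergman_h_poly :: "'a set \<Rightarrow> 'a set set \<Rightarrow> rat poly" where
  "bergman_h_poly E Bs = pcompose (bergman_f_poly E Bs) [:-1, 1:]"

text \<open>Polynomials over Q in variables indexed by type 'v:
  finitely supported maps from monomials (finitely supported exponent vectors) to Q.\<close>
type_synonym 'v mpoly = "('v \<Rightarrow>\<^sub>0 nat) \<Rightarrow>\<^sub>0 rat"

definition mvar :: "'v \<Rightarrow> 'v mpoly" where
  "mvar v = Poly_Mapping.single (Poly_Mapping.single v 1) 1"

definition mon_deg :: "('v \<Rightarrow>\<^sub>0 nat) \<Rightarrow> nat" where
  "mon_deg m = (\<Sum>v\<in>Poly_Mapping.keys m. Poly_Mapping.lookup m v)"

definition polys_in :: "'v set \<Rightarrow> 'v mpoly set" where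
  "polys_in V = {p. \<forall>m\<in>Poly_Mapping.keys p. Poly_Mapping.keys m \<subseteq> V}"

definition homog_part :: "'v set \<Rightarrow> nat \<Rightarrow> 'v mpoly set" where
  "homog_part V j = {p \<in> polys_in V. \<forall>m\<in>Poly_Mapping.keys p. mon_deg m = j}"

inductive_set ideal_in :: "'v set \<Rightarrow> 'v mpoly set \<Rightarrow> 'v mpoly set"
  for V :: "'v set" and G :: "'v mpoly set" where
  gen: "g \<in> G \<Longrightarrow> g \<in> ideal_in V G"
| zero: "0 \<in> ideal_in V G"
| add: "a \<in> ideal_in V G \<Longrightarrow> b \<in> ideal_in V G \<Longrightarrow> a + b \<in> ideal_in V G"
| mult: "a \<in> ideal_in V G \<Longrightarrow> s \<in> polys_in V \<Longrightarrow> s * a \<in> ideal_in V G"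

definition qscale :: "rat \<Rightarrow> 'v mpoly \<Rightarrow> 'v mpoly" where
  "qscale c p = Poly_Mapping.map (\<lambda>x. c * x) p"

definition chow_gens :: "'a set \<Rightarrow> 'a set set \<Rightarrow> 'a set mpoly set" where
  "chow_gens E Bs =
     {mvar F * mvar G | F G. F \<in> proper_flats E Bs \<and> G \<in> proper_flats E Bs
                            \<and> \<not> F \<subseteq> G \<and> \<not> G \<subseteq> F}
   \<union> {(\<Sum>F\<in>{F\<in>proper_flats E Bs. i \<in> F}. mvar F)
       - (\<Sum>F\<in>{F\<in>proper_flats E Bs. j \<in> F}. mvar F) | i j. i \<in> E \<and> j \<in> E}"

text \<open>dim_Q of the degree-j part of the (graded) Chow ring
  Q[x_F : F proper flat] / (I + J).\<close>
definition chow_dim :: "'a set \<Rightarrow> 'a set set \<Rightarrow> nat \<Rightarrow> nat" where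
  "chow_dim E Bs j =
     vector_space.dim qscale (homog_part (proper_flats E Bs) j)
   - vector_space.dim qscale
       (homog_part (proper_flats E Bs) j \<inter> ideal_in (proper_flats E Bs) (chow_gens E Bs))"

text \<open>Hilbert series of the Chow ring (a formal power series; a posteriori a polynomial).\<close>
definition chow_hilbert :: "'a set \<Rightarrow> 'a set set \<Rightarrow> rat fps" where
  "chow_hilbert E Bs = Abs_fps (\<lambda>j. of_nat (chow_dim E Bs j))"

lemma qscale_vector_space: "vector_space (qscale :: rat \<Rightarrow> 'v mpoly \<Rightarrow> 'v mpoly)"
  unfolding vector_space_def qscale_def
  by (auto simp: poly_mapping_eq_iff algebra_simps
      Poly_Mapping.map.rep_eq Poly_Mapping.lookup_add when_def intro!: ext)
     (metis distrib_left mult_zero_right)+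

end

theory Submission
  imports Defs
begin

text \<open>
  Write \<open>alpha\<close> for the class of \<open>\<Sum>F \<ni> i. x\<^sub>F\<close> in the Chow ring of \<open>U\<^sub>k\<^sub>,\<^sub>n\<close>; its proper flats are the nonempty
  sets of size less than \<open>k\<close>. The Feichtner--Yuzvinsky monomials \<open>x\<^sup>m alpha\<^sup>e\<close>, where \<open>m\<close> lives on a
  chain of flats with \<open>m F + |F'| < |F|\<close> (\<open>F'\<close> the predecessor of \<open>F\<close> in the chain) and
  \<open>e < k - |top m|\<close>, form a basis of the Chow ring.
  They span because the relations \<open>x\<^sub>G (\<Sum>H \<supseteq> F. x\<^sub>H - alpha)\<^bsup>|F - G|\<^esup> = 0\<close> push exponents to larger
  flats. They are independent because the degree functional, given on chain monomials by an explicit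
  product of binomial coefficients, pairs them triangularly with complementary monomials.

  Counting basis monomials by the top of their chain gives the Hilbert series
  \<open>\<Sum>m<k. (n choose m) Der m (1 + x + \<dots> + x\<^bsup>k-m-1\<^esup>)\<close> with derangement polynomials \<open>Der\<close>; counting chains
  in the same way gives \<open>h = \<Sum>m<k. (n choose m) Eul m (x - 1)\<^bsup>k-m-1\<^esup>\<close> with Eulerian polynomials \<open>Eul\<close>.
  Since \<open>Eul n = \<Sum>m\<le>n. (n choose m) Der m\<close>, the theorem reduces to
  \<open>\<Sum>t<K. (N choose t) (x - 1)\<^bsup>K-1-t\<^esup> = \<Sum>i=1..K. (N - i - 1 choose K - i) (1 + \<dots> + x\<^bsup>i-1\<^esup>)\<close>, which holds
  for \<open>N = K\<close> and is preserved by Pascal's rule.\<close>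

subsection \<open>Eulerian and derangement polynomials\<close>

text \<open>Dimensions are defined as differences, so the quotient ring is never formed:
  independence has to be proved modulo the ideal, which calls for a functional that kills the ideal.
  An explicit formula supplies it, and the burden shifts to checking that the formula respects the
  linear relations. Multiplication by alpha corresponds to truncating the matroid by one rank, and
  the formula does not see the rank. Hence the check takes a sharp form: summing the degree of x^m
  x_H over all H containing i gives the degree of x^m, whatever i is. The same fact evaluates every
  power of alpha, so the basis elements with alpha^e need no separate treatment. On the polynomial
  side, everything is expanded in the terms (n choose m) Der m; what is left to compare are their
  cofactors, which involve no chains at all.\<close>

definition Qp :: "nat \<Rightarrow> rat poly" where
  "Qp g = (\<Sum>i<g. monom 1 i)"

text \<open>For K at most N this is the quotient of x^N on division by (x - 1)^(N - K + 1): expand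
  x^N = (1 + (x - 1))^N and discard the low powers of x - 1.\<close>

definition Lp :: "nat \<Rightarrow> nat \<Rightarrow> rat poly" where
  "Lp N K = (\<Sum>t<K. of_nat (N choose t) * [:-1, 1:] ^ (K - 1 - t))"

lemma Lp_Pascal: "Lp (Suc N) (Suc K) = Lp N (Suc K) + Lp N K"
proof -
  have "Lp (Suc N) (Suc K) = [:-1,1:]^K + (\<Sum>t<K. of_nat (Suc N choose Suc t) * [:-1, 1:] ^ (K - Suc t))"
    unfolding Lp_def by (subst sum.lessThan_Suc_shift) simp
  also have "\<dots> = ([:-1,1:]^K + (\<Sum>t<K. of_nat (N choose Suc t) * [:-1, 1:] ^ (K - Suc t)))
     + (\<Sum>t<K. of_nat (N choose t) * [:-1, 1:] ^ (K - Suc t))"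
    by (simp add: sum.distrib[symmetric] algebra_simps del: mult_pCons_left mult_pCons_right)
  also have "[:-1,1:]^K + (\<Sum>t<K. of_nat (N choose Suc t) * [:-1, 1:] ^ (K - Suc t)) = Lp N (Suc K)"
    unfolding Lp_def by (subst sum.lessThan_Suc_shift) simp
  finally show ?thesis by (simp add: Lp_def)
qed

lemma Lp_diag: "Lp K K = Qp K"
proof -
  let ?y = "[:-1, 1:] :: rat poly"
  have y1: "1 + ?y = monom 1 1" by (simp add: monom_Suc one_pCons)
  have "?y * Lp K K = (\<Sum>t<K. of_nat (K choose t) * 1 ^ t * ?y ^ (K - t))"
    unfolding Lp_def sum_distrib_left
    by (rule sum.cong) (auto simp: mult.assoc[symmetric] mult.commute[of ?y] Suc_diff_Suc simp flip: power_Suc2 power_Suc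
        simp del: mult_pCons_left mult_pCons_right)
  also have "\<dots> = (1 + ?y) ^ K - 1"
    by (subst binomial_ring) (simp add: lessThan_Suc_atMost[symmetric] del: add_pCons)
  also have "\<dots> = monom 1 1 ^ K - 1" using y1 by simp
  also have "\<dots> = (monom 1 1 - 1) * (\<Sum>i<K. monom 1 1 ^ i)"
    by (rule power_diff_1_eq)
  also have "\<dots> = ?y * Qp K"
  proof -
    have "monom 1 1 - 1 = ?y" using y1 by (simp add: algebra_simps)
    then show ?thesis by (simp only: Qp_def monom_power power_one mult_1)
  qed
  finally show ?thesis by (subst (asm) mult_cancel_left) auto
qed

lemma Lp_eq_sum_Qp:
  assumes "K \<le> N"
  shows "Lp N K = (\<Sum>i=1..K. smult ((of_nat N - of_nat i - 1) gchoose (K - i)) (Qp i))"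
  using assms
proof (induction N arbitrary: K rule: nat_induct)
  case 0 then show ?case by (simp add: Lp_def)
next
  case (Suc N)
  show ?case
  proof (cases "K = Suc N")
    case True
    \<comment> \<open>For i < K = N + 1 the coefficient is (K - i - 1 choose K - i) = 0; for i = K
      it is \<open>-1 gchoose 0 = 1\<close>, the convention of the theorem.\<close>
    have "smult ((of_nat (Suc N) - of_nat i - 1) gchoose (K - i)) (Qp i) = (if i = K then Qp K else 0)"
      if "i \<in> {1..K}" for i
    proof (cases "i = K")
      case False
      then have e: "of_nat (Suc N) - of_nat i - 1 = (of_nat (N - i) :: rat)" using that True by (simp add: of_nat_diff)
      moreover have "(of_nat (N - i) gchoose (K - i)) = (0::rat)"
        unfolding binomial_gbinomial[symmetric] using that True False by (auto simp: binomial_eq_0 Suc_diff_le)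
      ultimately have "(of_nat (Suc N) - of_nat i - 1) gchoose (K - i) = (0::rat)" by (simp only:)
      then show ?thesis using False by (simp only: smult_0_left if_False)
    qed simp
    then show ?thesis using True by (simp add: Lp_diag)
  next
    case False
    then have le: "K \<le> N" using Suc.prems by simp
    show ?thesis
    proof (cases K)
      case 0 then show ?thesis by (simp add: Lp_def)
    next
      case (Suc K')
      \<comment> \<open>The top term stays apart: its lower index is 0, so Pascal's rule does not
        split it.\<close>
      have "(\<Sum>i=1..Suc K'. smult ((of_nat (Suc N) - of_nat i - 1) gchoose (Suc K' - i)) (Qp i)) =
        Qp (Suc K') + (\<Sum>i=1..K'. smult ((of_nat (Suc N) - of_nat i - 1) gchoose (Suc K' - i)) (Qp i))"
        by simp
      also have "(\<Sum>i=1..K'. smult ((of_nat (Suc N) - of_nat i - 1) gchoose (Suc K' - i)) (Qp i)) =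
        (\<Sum>i=1..K'. smult ((of_nat N - of_nat i - 1) gchoose (Suc K' - i)) (Qp i)
          + smult ((of_nat N - of_nat i - 1) gchoose (K' - i)) (Qp i))"
      proof (rule sum.cong[OF refl])
        fix i assume i: "i \<in> {1..K'}"
        have "(((of_nat N - of_nat i - 1 :: rat) + 1) gchoose (Suc (K' - i))) =
           ((of_nat N - of_nat i - 1) gchoose (K' - i)) + ((of_nat N - of_nat i - 1) gchoose (Suc (K' - i)))"
          by (rule gbinomial_Suc_Suc)
        then show "smult ((of_nat (Suc N) - of_nat i - 1) gchoose (Suc K' - i)) (Qp i) =
           smult ((of_nat N - of_nat i - 1) gchoose (Suc K' - i)) (Qp i)
          + smult ((of_nat N - of_nat i - 1) gchoose (K' - i)) (Qp i)"
          using i by (simp add: Suc_diff_le smult_add_left[symmetric] add.commute)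
      qed
      finally show ?thesis using Suc.IH[of K'] Suc.IH[of K] le Suc
        by (simp add: Lp_Pascal sum.distrib)
    qed
  qed
qed

text \<open>Both recursions mirror the removal of the largest flat, of size \<open>m\<close>, from a
  chain whose remaining part has top of size \<open>l\<close>. In \<open>Der\<close> the removed
  flat carries an exponent \<open>d\<close> below the gap \<open>m - l\<close>; in
  \<open>Eul\<close> the power of x - 1 counts the m - l - 1 sizes skipped.\<close>

fun Der :: "nat \<Rightarrow> rat poly" where
  "Der m = (if m = 0 then 1 else (\<Sum>l<m. of_nat (m choose l) * Der l * (\<Sum>d=1..<m - l. monom 1 d)))"

fun Eul :: "nat \<Rightarrow> rat poly" where
  "Eul m = (if m = 0 then 1 else (\<Sum>l<m. of_nat (m choose l) * Eul l * [:-1, 1:] ^ (m - l - 1)))"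

declare Der.simps[simp del] Eul.simps[simp del]

lemma sum_Qp: "0 < g \<Longrightarrow> Qp g = 1 + (\<Sum>d=1..<g. monom 1 d)"
  unfolding Qp_def by (simp add: lessThan_atLeast0 sum.atLeast_Suc_lessThan)

text \<open>Trinomial revision: the inner m-set may be chosen first, leaving l - m out of N - m
  points. The case N = K drives the induction for \<open>Eul\<close>; general N serves the
  h-polynomial.\<close>

lemma double_binomial_sum:
  assumes "K \<le> N"
  shows "(\<Sum>l<K. of_nat (N choose l) * (\<Sum>m\<le>l. of_nat (l choose m) * Der m) * [:-1, 1:] ^ (K - l - 1)) =
    (\<Sum>m<K. of_nat (N choose m) * Der m * Lp (N - m) (K - m))"
proof -
  have "(\<Sum>l<K. of_nat (N choose l) * (\<Sum>m\<le>l. of_nat (l choose m) * Der m) * [:-1, 1:] ^ (K - l - 1)) =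
    (\<Sum>l<K. \<Sum>m\<le>l. of_nat ((N choose l) * (l choose m)) * Der m * [:-1, 1:] ^ (K - l - 1))"
    by (simp add: sum_distrib_left sum_distrib_right mult_ac del: mult_pCons_left mult_pCons_right)
  also have "\<dots> = (\<Sum>l<K. \<Sum>m\<in>{m. m < K \<and> m \<le> l}. of_nat ((N choose m) * (N - m choose (l - m))) * Der m * [:-1, 1:] ^ (K - l - 1))"
    by (intro sum.cong) (use assms in \<open>auto simp: choose_mult\<close>)
  also have "\<dots> = (\<Sum>m<K. \<Sum>l\<in>{l. l < K \<and> m \<le> l}. of_nat ((N choose m) * (N - m choose (l - m))) * Der m * [:-1, 1:] ^ (K - l - 1))"
    using sum.swap_restrict[of "{..<K}" "{..<K}" "\<lambda>l m. of_nat ((N choose m) * (N - m choose (l - m))) * Der m * [:-1, 1:] ^ (K - l - 1)" "\<lambda>l m. m \<le> l"]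
    by simp
  also have "\<dots> = (\<Sum>m<K. of_nat (N choose m) * Der m * Lp (N - m) (K - m))"
  proof (rule sum.cong[OF refl])
    fix m assume m: "m \<in> {..<K}"
    show "(\<Sum>l\<in>{l. l < K \<and> m \<le> l}. of_nat ((N choose m) * (N - m choose (l - m))) * Der m * [:-1, 1:] ^ (K - l - 1))
      = of_nat (N choose m) * Der m * Lp (N - m) (K - m)"
      unfolding Lp_def sum_distrib_left
      by (rule sum.reindex_bij_witness[where i="\<lambda>t. t + m" and j="\<lambda>l. l - m"])
         (use m in \<open>auto simp: mult_ac simp del: mult_pCons_left mult_pCons_right\<close>)
  qed
  finally show ?thesis .
qed

text \<open>By induction, \<open>Eul n\<close> is the sum of (n choose m) Der m Qp (n - m) over m <
  n. The constant term of each \<open>Qp\<close> yields the summands with m < n, and the positive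
  powers reassemble the recursion of \<open>Der n\<close>.\<close>

lemma Eul_eq_sum_Der: "Eul n = (\<Sum>m\<le>n. of_nat (n choose m) * Der m)"
proof (induction n rule: less_induct)
  case (less n)
  show ?case
  proof (cases "n = 0")
    case True then show ?thesis by (simp add: Eul.simps Der.simps)
  next
    case False
    have "Eul n = (\<Sum>l<n. of_nat (n choose l) * Eul l * [:-1, 1:] ^ (n - l - 1))"
      using False by (subst Eul.simps) simp
    also have "\<dots> = (\<Sum>l<n. of_nat (n choose l) * (\<Sum>m\<le>l. of_nat (l choose m) * Der m) * [:-1, 1:] ^ (n - l - 1))"
      by (rule sum.cong) (use less in auto)
    also have "\<dots> = (\<Sum>m<n. of_nat (n choose m) * Der m * Qp (n - m))"
      by (subst double_binomial_sum) (auto simp: Lp_diag)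
    also have "\<dots> = (\<Sum>m<n. of_nat (n choose m) * Der m + of_nat (n choose m) * Der m * (\<Sum>d=1..<n - m. monom 1 d))"
      by (intro sum.cong) (auto simp: sum_Qp algebra_simps)
    also have "\<dots> = (\<Sum>m<n. of_nat (n choose m) * Der m) + Der n"
      using False by (subst (3) Der.simps) (simp add: sum.distrib)
    also have "\<dots> = (\<Sum>m\<le>n. of_nat (n choose m) * Der m)"
      by (simp add: lessThan_Suc_atMost[symmetric])
    finally show ?thesis .
  qed
qed

lemma Eul_sum_identity:
  assumes "K \<le> N"
  shows "(\<Sum>m<K. of_nat (N choose m) * Eul m * [:-1, 1:] ^ (K - m - 1)) =
    (\<Sum>i=1..K. smult ((of_nat N - of_nat i - 1) gchoose (K - i))
       (\<Sum>m<i. of_nat (N choose m) * Der m * Qp (i - m)))"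
proof -
  let ?g = "\<lambda>i. (of_nat N - of_nat i - 1 :: rat) gchoose (K - i)"
  have "(\<Sum>m<K. of_nat (N choose m) * Eul m * [:-1, 1:] ^ (K - m - 1)) =
     (\<Sum>m<K. of_nat (N choose m) * Der m * Lp (N - m) (K - m))"
    using double_binomial_sum[OF assms] by (simp add: Eul_eq_sum_Der)
  also have "\<dots> = (\<Sum>m<K. \<Sum>i\<in>{i\<in>{1..K}. m < i}. smult (?g i) (of_nat (N choose m) * Der m * Qp (i - m)))"
  proof (rule sum.cong[OF refl])
    fix m assume m: "m \<in> {..<K}"
    have "Lp (N - m) (K - m) = (\<Sum>j=1..K - m. smult ((of_nat (N - m) - of_nat j - 1) gchoose (K - m - j)) (Qp j))"
      using assms by (intro Lp_eq_sum_Qp) auto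
    \<comment> \<open>With i = j + m the coefficient depends on N, K and i only, so it can later
      leave the sum over m.\<close>
    also have "\<dots> = (\<Sum>i\<in>{i\<in>{1..K}. m < i}. smult (?g i) (Qp (i - m)))"
      by (rule sum.reindex_bij_witness[where i="\<lambda>i. i - m" and j="\<lambda>j. j + m"])
         (use m assms in \<open>auto simp: of_nat_diff algebra_simps\<close>)
    finally show "of_nat (N choose m) * Der m * Lp (N - m) (K - m) =
      (\<Sum>i\<in>{i\<in>{1..K}. m < i}. smult (?g i) (of_nat (N choose m) * Der m * Qp (i - m)))"
      by (simp add: sum_distrib_left)
  qed
  also have "\<dots> = (\<Sum>i=1..K. \<Sum>m\<in>{m\<in>{..<K}. m < i}. smult (?g i) (of_nat (N choose m) * Der m * Qp (i - m)))"
    by (rule sum.swap_restrict) auto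
  also have "\<dots> = (\<Sum>i=1..K. smult (?g i) (\<Sum>m<i. of_nat (N choose m) * Der m * Qp (i - m)))"
  proof (rule sum.cong[OF refl])
    fix i assume "i \<in> {1..K}"
    then have "{m\<in>{..<K}. m < i} = {..<i}" by auto
    then show "(\<Sum>m\<in>{m\<in>{..<K}. m < i}. smult (?g i) (of_nat (N choose m) * Der m * Qp (i - m)))
      = smult (?g i) (\<Sum>m<i. of_nat (N choose m) * Der m * Qp (i - m))"
      using sum_distrib_left[of "[:?g i:]" "\<lambda>m. of_nat (N choose m) * Der m * Qp (i - m)" "{..<i}"] by simp
  qed
  finally show ?thesis .
qed

subsection \<open>The degree functional on chain monomials\<close>

lemma sum_split_pred: "finite A \<Longrightarrow> sum f A = sum f {x\<in>A. P x} + sum f {x\<in>A. \<not> P x}"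
  by (subst sum.union_disjoint[symmetric]) (auto intro!: sum.cong)

locale finite_ground =
  fixes E :: "'a set"
  assumes finE: "finite E"
begin

fun nextflat :: "('a set \<times> nat) list \<Rightarrow> 'a set" where
  "nextflat [] = E"
| "nextflat ((F, d) # xs) = F"

text \<open>
  For a chain \<open>F\<^sub>1 \<subset> \<dots> \<subset> F\<^sub>r\<close> with exponents \<open>d\<^sub>i\<close>, partial sums \<open>D\<^sub>i = d\<^sub>1 + \<dots> + d\<^sub>i\<close> and \<open>F\<^bsub>r+1\<^esub> = E\<close>,
  \<open>degR 0\<close> is Eur's formula for the degree of a monomial in the Chow ring, namely the product of
  \<open>(-1)\<^bsup>d\<^sub>i - 1\<^esup> (d\<^sub>i - 1 choose D\<^sub>i - |F\<^sub>i|) (|F\<^bsub>i+1\<^esub>| - |F\<^sub>i| - 1 choose D\<^sub>i - |F\<^sub>i|)\<close>.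
  It does not mention the rank: in degree \<open>k - 1\<close> it is the degree map of \<open>U\<^sub>k\<^sub>,\<^sub>n\<close>, for every \<open>k\<close> at once.
  The case distinction is needed because the subtraction \<open>D + d - card F\<close> truncates.\<close>

fun degR :: "nat \<Rightarrow> ('a set \<times> nat) list \<Rightarrow> rat" where
  "degR D [] = 1"
| "degR D ((F, d) # xs) =
     (if card F \<le> D + d
      then (-1) ^ (d - 1) * of_nat (d - 1 choose (D + d - card F))
           * of_nat (card (nextflat xs) - card F - 1 choose (D + d - card F)) * degR (D + d) xs
      else 0)"

text \<open>Degree of the part of a chain above \<open>G\<close> when the part up to
  \<open>G\<close> has degree \<open>D\<close>. The binomial is the factor of \<open>G\<close> in
  Eur's formula that involves the next member, hence the one that changes when a flat is inserted
  just above \<open>G\<close>. It is 1 for \<open>G = {}\<close> and \<open>D = 0\<close>.\<close>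

definition degC :: "'a set \<Rightarrow> nat \<Rightarrow> ('a set \<times> nat) list \<Rightarrow> rat" where
  "degC G D xs = of_nat (card (nextflat xs) - card G - 1 choose (D - card G)) * degR D xs"

fun chain_above :: "'a set \<Rightarrow> ('a set \<times> nat) list \<Rightarrow> bool" where
  "chain_above G [] \<longleftrightarrow> G \<subset> E"
| "chain_above G ((F, d) # xs) \<longleftrightarrow> G \<subset> F \<and> 0 < d \<and> chain_above F xs"

fun ins :: "'a set \<Rightarrow> ('a set \<times> nat) list \<Rightarrow> ('a set \<times> nat) list" where
  "ins H [] = [(H, 1)]"
| "ins H ((F, d) # xs) =
     (if H = F then (F, Suc d) # xs else if H \<subset> F then (H, 1) # (F, d) # xs else (F, d) # ins H xs)"

fun comparable_above :: "'a set \<Rightarrow> ('a set \<times> nat) list \<Rightarrow> 'a set set" where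
  "comparable_above G xs = {H. G \<subset> H \<and> H \<subset> E \<and> (\<forall>F\<in>fst ` set xs. H \<subseteq> F \<or> F \<subseteq> H)}"

lemma finite_between: "finite {H. G \<subset> H \<and> H \<subset> E \<and> P H}"
  by (rule finite_subset[of _ "Pow E"]) (use finE in auto)

lemma chain_above_subset: "chain_above G xs \<Longrightarrow> G \<subset> E"
proof (induction xs arbitrary: G)
  case (Cons x xs)
  then show ?case by (cases x) (auto intro: psubset_trans simp del: psubset_eq)
qed simp

lemma chain_above_nextflat: "chain_above G xs \<Longrightarrow> G \<subset> nextflat xs"
  by (cases xs) auto

lemma chain_above_nextflat_le: "chain_above G xs \<Longrightarrow> nextflat xs \<subseteq> E"
proof (cases xs)
  case (Cons x ys)
  then show "chain_above G xs \<Longrightarrow> nextflat xs \<subseteq> E"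
    using chain_above_subset[of "fst x" ys] by (cases x) auto
qed simp

lemma chain_above_mem: "chain_above G xs \<Longrightarrow> F \<in> fst ` set xs \<Longrightarrow> G \<subset> F \<and> F \<subset> E"
proof (induction xs arbitrary: G)
  case (Cons x xs)
  obtain F' d where x: "x = (F', d)" by (cases x)
  then have G: "G \<subset> F'" and c: "chain_above F' xs" using Cons.prems by auto
  show ?case
  proof (cases "F = F'")
    case True then show ?thesis using G chain_above_subset[OF c] by simp
  next
    case False
    then have "F' \<subset> F \<and> F \<subset> E" using Cons.IH[OF c] Cons.prems(2) x by auto
    then show ?thesis using G by (meson psubset_trans)
  qed
qed simp

lemma degC_Cons:
  "card F \<le> D + d \<Longrightarrow> degC G D ((F, d) # xs) =
     of_nat (card F - card G - 1 choose (D - card G)) *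
       ((-1) ^ (d - 1) * of_nat (d - 1 choose (D + d - card F))) * degC F (D + d) xs"
  by (simp add: degC_def)

lemma degC_Cons_0: "\<not> card F \<le> D + d \<Longrightarrow> degC G D ((F, d) # xs) = 0"
  by (simp add: degC_def)

lemma degR_Suc_cong:
  "card F \<le> Suc (D + d) \<Longrightarrow> degR (Suc D) ((F, d) # xs) =
     ((-1) ^ (d - 1) * of_nat (d - 1 choose (Suc (D + d) - card F))) * degC F (Suc (D + d)) xs"
  by (simp add: degC_def)

lemma card_sets_between:
  assumes "G \<subseteq> T" "finite T"
  shows "card {H. G \<subseteq> H \<and> H \<subseteq> T \<and> card H = m} = (if card G \<le> m then card T - card G choose (m - card G) else 0)"
proof (cases "card G \<le> m")
  case True
  have "bij_betw (\<lambda>H. H - G) {H. G \<subseteq> H \<and> H \<subseteq> T \<and> card H = m} {K. K \<subseteq> T - G \<and> card K = m - card G}"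
    by (rule bij_betw_byWitness[where f'="\<lambda>K. K \<union> G"])
       (use assms True in \<open>auto simp: card_Diff_subset finite_subset card_Un_disjoint Int_commute
          intro!: card_Un_disjoint[THEN trans] dest: finite_subset\<close>)
  then have "card {H. G \<subseteq> H \<and> H \<subseteq> T \<and> card H = m} = card {K. K \<subseteq> T - G \<and> card K = m - card G}"
    by (rule bij_betw_same_card)
  also have "\<dots> = card T - card G choose (m - card G)"
    using assms by (simp add: n_subsets card_Diff_subset finite_subset)
  finally show ?thesis using True by simp
next
  case False
  have "\<not> (G \<subseteq> H \<and> H \<subseteq> T \<and> card H = m)" for H
    using assms(2) False card_mono finite_subset by metis
  then have "{H. G \<subseteq> H \<and> H \<subseteq> T \<and> card H = m} = {}" by blast
  then show ?thesis using False by (simp only: card.empty if_False)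
qed

text \<open>The size test of \<open>degR\<close> rules out larger H, and the factor (0 choose Suc D
  - card H) rules out smaller ones. At size \<open>Suc D\<close> all new binomials are 1.\<close>

lemma degC_insert_front:
  assumes "chain_above G xs" "G \<subset> H" "H \<subset> nextflat xs" "card G \<le> D"
  shows "degC G D ((H, 1) # xs) = (if card H = Suc D then degR (Suc D) xs else 0)"
proof -
  have fin: "finite H" using assms chain_above_nextflat_le finE by (metis finite_subset psubset_imp_subset)
  then have "card G < card H" using assms psubset_card_mono by blast
  then show ?thesis using assms(4)
    by (auto simp: degC_def binomial_eq_0 Suc_diff_le)
qed

lemma sum_degC_insert_front:
  assumes "chain_above G xs" "card G \<le> D" "\<And>H. H \<in> S \<Longrightarrow> G \<subset> H \<and> H \<subset> nextflat xs" "finite S"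
  shows "(\<Sum>H\<in>S. degC G D ((H, 1) # xs)) = of_nat (card {H\<in>S. card H = Suc D}) * degR (Suc D) xs"
proof -
  have "(\<Sum>H\<in>S. degC G D ((H, 1) # xs)) = (\<Sum>H\<in>S. if card H = Suc D then degR (Suc D) xs else 0)"
    by (rule sum.cong[OF refl], rule degC_insert_front) (use assms in auto)
  also have "\<dots> = (\<Sum>H\<in>{H\<in>S. card H = Suc D}. degR (Suc D) xs)"
    by (rule sum.inter_filter[symmetric]) fact
  finally show ?thesis by simp
qed

definition total :: "('a set \<times> nat) list \<Rightarrow> nat" where
  "total xs = sum_list (map snd xs)"

text \<open>A comparable H that omits an element of the next member lies strictly between F and that
  member. Only size \<open>Suc D\<close> counts, and the number of such sets is the leading binomial
  of \<open>degC F (Suc D) ys\<close>.\<close>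

lemma sum_insert_missing:
  assumes "chain_above F ys" "card F \<le> D" "i \<in> nextflat ys - F" "D + total ys + 2 \<le> card E"
  shows "(\<Sum>H\<in>{H\<in>comparable_above F ys. i \<notin> H}. degC F D (ins H ys)) = degC F (Suc D) ys"
proof -
  have le: "nextflat ys \<subseteq> E" using assms chain_above_nextflat_le by blast
  have sub: "F \<subset> nextflat ys" using assms chain_above_nextflat by blast
  let ?S = "{H. F \<subset> H \<and> H \<subset> nextflat ys \<and> i \<notin> H}"
  have S: "{H\<in>comparable_above F ys. i \<notin> H} = ?S"
  proof (cases ys)
    case Nil then show ?thesis by auto
  next
    case (Cons y zs)
    obtain F2 d2 where y: "y = (F2, d2)" by (cases y)
    have c: "chain_above F2 zs" using assms Cons y by auto
    have i: "i \<in> F2" using assms(3) Cons y by simp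
    have "F \<subset> H \<and> H \<subset> F2" if H: "H \<in> comparable_above F ys" "i \<notin> H" for H
    proof -
      have "F \<subset> H" "H \<subseteq> F2 \<or> F2 \<subseteq> H" using H Cons y by auto
      then show ?thesis using i H(2) by blast
    qed
    moreover have "H \<in> comparable_above F ys" if H: "F \<subset> H" "H \<subset> F2" for H
    proof -
      have "H \<subseteq> F'" if "F' \<in> fst ` set ys" for F'
        using that Cons y chain_above_mem[OF c, of F'] H by auto
      then show ?thesis using H chain_above_subset[OF c] by auto
    qed
    ultimately show ?thesis using Cons y by (auto simp del: comparable_above.simps)
  qed
  have finS: "finite ?S" by (rule finite_subset[of _ "Pow E"]) (use finE le in auto)
  have "(\<Sum>H\<in>?S. degC F D (ins H ys)) = (\<Sum>H\<in>?S. degC F D ((H, 1) # ys))"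
  proof (rule sum.cong[OF refl])
    fix H assume "H \<in> ?S"
    then have "H \<subset> nextflat ys" by blast
    then have "ins H ys = (H, 1) # ys" by (cases ys rule: nextflat.cases) simp_all
    then show "degC F D (ins H ys) = degC F D ((H, 1) # ys)" by simp
  qed
  also have "\<dots> = of_nat (card {H\<in>?S. card H = Suc D}) * degR (Suc D) ys"
    by (rule sum_degC_insert_front) (use assms finS in auto)
  also have "card {H\<in>?S. card H = Suc D} = card (nextflat ys) - card F - 1 choose (Suc D - card F)"
  proof -
    have "{H\<in>?S. card H = Suc D} = {H. F \<subseteq> H \<and> H \<subseteq> nextflat ys - {i} \<and> card H = Suc D}"
      using assms(2,3) by auto
    moreover have "finite (nextflat ys)" using le finE finite_subset by blast
    moreover have "F \<subseteq> nextflat ys - {i}" using assms(3) sub by blast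
    ultimately show ?thesis using assms by (simp only: card_sets_between finite_Diff) simp
  qed
  finally show ?thesis unfolding S degC_def by simp
qed

text \<open>If \<open>i \<in> F\<close> for the next member \<open>F\<close>, the three kinds of insertions (below \<open>F\<close>, at \<open>F\<close>, above \<open>F\<close>) combine by
  Pascal's rule; to sum over all insertions above \<open>F\<close>, split them according to an element \<open>i'\<close> of the
  following member.\<close>

lemma sum_insert_containing:
  assumes "chain_above G xs" "card G \<le> D" "i \<in> E - G" "D + total xs + 2 \<le> card E"
  shows "(\<Sum>H\<in>{H\<in>comparable_above G xs. i \<in> H}. degC G D (ins H xs)) = degC G D xs"
  using assms
proof (induction xs arbitrary: G D i)
  case Nil
  let ?S = "{H\<in>comparable_above G []. i \<in> H}"
  have finS: "finite ?S" by (rule finite_subset[of _ "Pow E"]) (use finE in auto)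
  have "(\<Sum>H\<in>?S. degC G D (ins H [])) = (\<Sum>H\<in>?S. degC G D [(H, 1)])" by simp
  also have "\<dots> = of_nat (card {H\<in>?S. card H = Suc D}) * degR (Suc D) []"
    by (rule sum_degC_insert_front) (use Nil finS in auto)
  \<comment> \<open>The degree bound gives Suc D < card E, so the sets on the right are
    automatically proper.\<close>
  also have "{H\<in>?S. card H = Suc D} = {H. insert i G \<subseteq> H \<and> H \<subseteq> E \<and> card H = Suc D}"
    using Nil by (auto simp: total_def)
  also have "card \<dots> = card E - card G - 1 choose (D - card G)"
    using Nil finE by (subst card_sets_between) (auto dest: finite_subset)
  finally show ?case by (simp add: degC_def)
next
  case (Cons x ys)
  obtain F d where x: "x = (F, d)" by (cases x)
  have GF: "G \<subset> F" and d: "0 < d" and ch: "chain_above F ys" using Cons.prems x by auto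
  have FE: "F \<subset> E" using chain_above_subset ch .
  have finF: "finite F" using FE finE by (meson finite_subset psubset_imp_subset)
  have cGF: "card G < card F" using GF finF by (rule psubset_card_mono[rotated])
  have tot: "(D + d) + total ys + 2 \<le> card E" using Cons.prems x by (simp add: total_def)
  let ?s = "(-1::rat) ^ (d - 1)"
  let ?p = "of_nat (card F - card G - 1 choose (D - card G)) :: rat"
  show ?case
  proof (cases "i \<in> F")
    case False
    \<comment> \<open>As F lacks i, every admissible H lies above F and only the tail of the list
      changes.\<close>
    have set: "{H\<in>comparable_above G (x # ys). i \<in> H} = {H\<in>comparable_above F ys. i \<in> H}"
      using False x GF by auto
    have ins: "ins H (x # ys) = (F, d) # ins H ys" if "H \<in> {H\<in>comparable_above F ys. i \<in> H}" for H
      using that x by auto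
    show ?thesis
    proof (cases "card F \<le> D + d")
      case True
      have "(\<Sum>H\<in>{H\<in>comparable_above F ys. i \<in> H}. degC G D (ins H (x # ys))) =
        (\<Sum>H\<in>{H\<in>comparable_above F ys. i \<in> H}.
            ?p * (?s * of_nat (d - 1 choose (D + d - card F))) * degC F (D + d) (ins H ys))"
        by (rule sum.cong) (use ins True in \<open>simp_all add: degC_Cons\<close>)
      also have "\<dots> = ?p * (?s * of_nat (d - 1 choose (D + d - card F))) * degC F (D + d) ys"
        unfolding sum_distrib_left[symmetric]
        by (subst Cons.IH) (use Cons.prems ch True tot False in auto)
      finally show ?thesis unfolding set using True x by (simp add: degC_Cons)
    next
      case False
      then show ?thesis unfolding set using ins x by (simp add: degC_Cons_0)
    qed
  next
    case True
    let ?A = "{H. G \<subset> H \<and> H \<subset> F \<and> i \<in> H}"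
    have set: "{H\<in>comparable_above G (x # ys). i \<in> H} = ?A \<union> ({F} \<union> comparable_above F ys)"
    proof -
      have c1: "H \<in> comparable_above F ys" if "H \<in> comparable_above G (x # ys)" "H \<noteq> F" "\<not> H \<subset> F" for H
        using that x by auto
      have c2: "H \<in> comparable_above G (x # ys)" if H: "H \<subseteq> F" "G \<subset> H" for H
      proof -
        have "H \<subseteq> F'" if "F' \<in> fst ` set (x # ys)" for F'
          using that x chain_above_mem[OF ch, of F'] H by auto
        then show ?thesis using H FE by auto
      qed
      have c3: "H \<in> comparable_above G (x # ys) \<and> i \<in> H \<and> F \<subset> H" if "H \<in> comparable_above F ys" for H
        using that x True GF by auto
      have c4: "G \<subset> H" if "H \<in> comparable_above G (x # ys)" for H
        using that by auto
      show ?thesis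
      proof (rule set_eqI, rule iffI)
        fix H assume H: "H \<in> {H\<in>comparable_above G (x # ys). i \<in> H}"
        then show "H \<in> ?A \<union> ({F} \<union> comparable_above F ys)"
          using c1[of H] c4[of H] by (cases "H = F"; cases "H \<subset> F") simp_all
      next
        fix H assume "H \<in> ?A \<union> ({F} \<union> comparable_above F ys)"
        then consider "H \<in> ?A" | "H = F" | "H \<in> comparable_above F ys" by blast
        then show "H \<in> {H\<in>comparable_above G (x # ys). i \<in> H}"
        proof cases
          case 1 then show ?thesis using c2[of H] by (simp add: psubset_imp_subset del: comparable_above.simps)
        next
          case 2 then show ?thesis using c2[of F] GF True by (simp del: comparable_above.simps)
        next
          case 3 then show ?thesis using c3[of H] by (simp del: comparable_above.simps)
        qed
      qed
    qed
    have finA: "finite ?A" by (rule finite_subset[of _ "Pow F"]) (use finF in auto)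
    have finC: "finite (comparable_above F ys)" by (simp add: finite_between)
    have "(\<Sum>H\<in>{H\<in>comparable_above G (x # ys). i \<in> H}. degC G D (ins H (x # ys))) =
       (\<Sum>H\<in>?A. degC G D (ins H (x # ys))) + (degC G D (ins F (x # ys))
         + (\<Sum>H\<in>comparable_above F ys. degC G D (ins H (x # ys))))"
      unfolding set using finA finC
      by (subst sum.union_disjoint) auto
    also have "(\<Sum>H\<in>?A. degC G D (ins H (x # ys))) = (\<Sum>H\<in>?A. degC G D ((H, 1) # x # ys))"
      by (rule sum.cong) (use x in auto)
    also have "\<dots> = of_nat (card {H\<in>?A. card H = Suc D}) * degR (Suc D) (x # ys)"
      by (rule sum_degC_insert_front) (use Cons.prems x finA in auto)
    also have "\<dots> = ?p * degR (Suc D) (x # ys)"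
    proof (cases "Suc D < card F")
      case True
      have "{H\<in>?A. card H = Suc D} = {H. insert i G \<subseteq> H \<and> H \<subseteq> F \<and> card H = Suc D}"
        using True Cons.prems \<open>i \<in> F\<close> by auto
      moreover have "insert i G \<subseteq> F" "card (insert i G) = Suc (card G)"
        using Cons.prems GF \<open>i \<in> F\<close> finF by (auto dest: finite_subset)
      ultimately show ?thesis using Cons.prems(2) card_sets_between[of "insert i G" F "Suc D"] finF by simp
    next
      case False
      \<comment> \<open>Both sides vanish here: the lower index in \<open>degR (Suc D)\<close> is at
        least d, and no proper subset of F has \<open>Suc D\<close> elements.\<close>
      have "d - 1 < Suc (D + d) - card F" using False d by linarith
      moreover have "card H \<noteq> Suc D" if "H \<subset> F" for H
        using False psubset_card_mono[OF finF that] by linarith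
      then have "{H\<in>?A. card H = Suc D} = {}" by blast
      ultimately show ?thesis using x d by (auto simp: binomial_eq_0)
    qed
    also have "degC G D (ins F (x # ys)) = degC G D ((F, Suc d) # ys)" using x by simp
    also have "(\<Sum>H\<in>comparable_above F ys. degC G D (ins H (x # ys))) =
        (\<Sum>H\<in>comparable_above F ys. degC G D ((F, d) # ins H ys))"
      by (rule sum.cong) (use x in auto)
    also have "?p * degR (Suc D) (x # ys) + (degC G D ((F, Suc d) # ys) +
        (\<Sum>H\<in>comparable_above F ys. degC G D ((F, d) # ins H ys))) = degC G D (x # ys)"
    proof (cases "card F \<le> Suc (D + d)")
      case False
      then show ?thesis using x by (simp add: degC_Cons_0)
    next
      case le: True
      let ?c = "degC F (Suc (D + d)) ys"
      let ?b = "Suc (D + d) - card F"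
      have 1: "degR (Suc D) (x # ys) = ?s * of_nat (d - 1 choose ?b) * ?c"
        using le x degR_Suc_cong by blast
      \<comment> \<open>Raising the exponent of F flips the sign, which makes a cancellation by
        Pascal's rule possible.\<close>
      have 2: "degC G D ((F, Suc d) # ys) = - (?p * ?s * of_nat (d choose ?b) * ?c)"
      proof -
        have "(-1::rat) ^ d = - ?s" using d by (cases d) auto
        then show ?thesis using le degC_Cons[of F D "Suc d" G ys] by simp
      qed
      show ?thesis
      proof (cases "card F = Suc (D + d)")
        \<comment> \<open>The lower index \<open>?b\<close> is 0, so the first two contributions
          cancel; all other terms fail the size test.\<close>
        case True
        then show ?thesis unfolding 1 2 using x by (simp add: degC_Cons_0)
      next
        case False
        then have le': "card F \<le> D + d" using le by simp
        obtain i' where i': "i' \<in> nextflat ys - F" using chain_above_nextflat[OF ch] by auto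
        have i'E: "i' \<in> E - F" using i' chain_above_nextflat_le[OF ch] by auto
        have "(\<Sum>H\<in>comparable_above F ys. degC F (D + d) (ins H ys)) =
          (\<Sum>H\<in>{H\<in>comparable_above F ys. i' \<in> H}. degC F (D + d) (ins H ys)) +
          (\<Sum>H\<in>{H\<in>comparable_above F ys. i' \<notin> H}. degC F (D + d) (ins H ys))"
          by (rule sum_split_pred[OF finC])
        also have "\<dots> = degC F (D + d) ys + ?c"
          using Cons.IH[OF ch le' i'E tot] sum_insert_missing[OF ch le' i' tot] by simp
        finally have 3: "(\<Sum>H\<in>comparable_above F ys. degC G D ((F, d) # ins H ys)) =
           ?p * (?s * of_nat (d - 1 choose (D + d - card F))) * (degC F (D + d) ys + ?c)"
          using le' by (simp add: degC_Cons sum_distrib_left[symmetric] del: comparable_above.simps)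
        have b: "?b = Suc (D + d - card F)" using le' by simp
        \<comment> \<open>Up to a common factor, the coefficient of \<open>?c\<close> is (d-1 choose
          b) - (d choose b) + (d-1 choose b-1) = 0. What remains is
          \<open>degC G D (x # ys)\<close>.\<close>
        have "d choose ?b = (d - 1 choose (D + d - card F)) + (d - 1 choose ?b)"
          unfolding b using d by (cases d) auto
        then show ?thesis unfolding 1 2 3 using x le'
          by (simp add: degC_Cons algebra_simps)
      qed
    qed
    finally show ?thesis .
  qed
qed

end

section \<open>Degrees and partial degrees of monomials\<close>

lemma keys_add_nat: "Poly_Mapping.keys (a + b :: 'v \<Rightarrow>\<^sub>0 nat) = Poly_Mapping.keys a \<union> Poly_Mapping.keys b"
  by (auto simp: in_keys_iff lookup_add)

lemma mon_deg_superset: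
  "finite S \<Longrightarrow> Poly_Mapping.keys m \<subseteq> S \<Longrightarrow> mon_deg m = (\<Sum>v\<in>S. Poly_Mapping.lookup m v)"
  unfolding mon_deg_def by (rule sum.mono_neutral_left) (auto simp: in_keys_iff)

lemma mon_deg_add: "mon_deg (a + b) = mon_deg a + mon_deg b"
proof -
  let ?S = "Poly_Mapping.keys a \<union> Poly_Mapping.keys b"
  have "mon_deg (a + b) = (\<Sum>v\<in>?S. Poly_Mapping.lookup (a + b) v)"
    "mon_deg a = (\<Sum>v\<in>?S. Poly_Mapping.lookup a v)" "mon_deg b = (\<Sum>v\<in>?S. Poly_Mapping.lookup b v)"
    by (rule mon_deg_superset; simp add: keys_add_nat)+
  then show ?thesis by (simp add: lookup_add sum.distrib)
qed

lemma mon_deg_single [simp]: "mon_deg (Poly_Mapping.single v d) = d"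
  by (simp add: mon_deg_def)

lemma mon_deg_0 [simp]: "mon_deg 0 = 0"
  by (simp add: mon_deg_def)

text \<open>On a chain monomial, at a member F of its support, this is the partial sum of exponents
  in Eur's formula.\<close>

definition below :: "('a set \<Rightarrow>\<^sub>0 nat) \<Rightarrow> 'a set \<Rightarrow> nat" where
  "below m F = (\<Sum>G | G \<in> Poly_Mapping.keys m \<and> G \<subseteq> F. Poly_Mapping.lookup m G)"

lemma below_superset:
  "finite S \<Longrightarrow> Poly_Mapping.keys m \<subseteq> S \<Longrightarrow> below m F = (\<Sum>G | G \<in> S \<and> G \<subseteq> F. Poly_Mapping.lookup m G)"
  unfolding below_def by (rule sum.mono_neutral_left) (auto simp: in_keys_iff)

lemma below_add: "below (a + b) F = below a F + below b F"
proof -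
  let ?S = "Poly_Mapping.keys a \<union> Poly_Mapping.keys b"
  have "below (a + b) F = (\<Sum>G | G \<in> ?S \<and> G \<subseteq> F. Poly_Mapping.lookup (a + b) G)"
    "below a F = (\<Sum>G | G \<in> ?S \<and> G \<subseteq> F. Poly_Mapping.lookup a G)"
    "below b F = (\<Sum>G | G \<in> ?S \<and> G \<subseteq> F. Poly_Mapping.lookup b G)"
    by (rule below_superset; simp add: keys_add_nat)+
  then show ?thesis by (simp add: lookup_add sum.distrib)
qed

lemma below_single: "below (Poly_Mapping.single G d) F = (if G \<subseteq> F then d else 0)"
  by (subst below_superset[of "{G}"]) (auto simp: Collect_conv_if)

lemma below_0 [simp]: "below 0 F = 0"
  by (simp add: below_def)

lemma below_le_mon_deg: "below m F \<le> mon_deg m"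
  unfolding below_def mon_deg_def by (rule sum_mono2) auto

section \<open>The degree of an arbitrary monomial\<close>

context finite_ground
begin

definition list_mono :: "('a set \<times> nat) list \<Rightarrow> 'a set \<Rightarrow>\<^sub>0 nat" where
  "list_mono xs = (\<Sum>(F, d)\<leftarrow>xs. Poly_Mapping.single F d)"

lemma list_mono_Nil [simp]: "list_mono [] = 0"
  and list_mono_Cons [simp]: "list_mono ((F, d) # xs) = Poly_Mapping.single F d + list_mono xs"
  by (simp_all add: list_mono_def)

lemma keys_list_mono: "chain_above G xs \<Longrightarrow> Poly_Mapping.keys (list_mono xs) = fst ` set xs"
proof (induction xs arbitrary: G)
  case (Cons x xs)
  then show ?case by (cases x) (auto simp: keys_add_nat)
qed simp

lemma mon_deg_list_mono: "mon_deg (list_mono xs) = total xs"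
  by (induction xs) (auto simp: mon_deg_add total_def)

text \<open>A nonzero product passes the size test at every member. This necessary condition is what
  makes the pairing triangular.\<close>

lemma degR_nonzero:
  "chain_above G xs \<Longrightarrow> degR D xs \<noteq> 0 \<Longrightarrow> H \<in> fst ` set xs \<Longrightarrow> card H \<le> D + below (list_mono xs) H"
proof (induction xs arbitrary: G D)
  case (Cons x xs)
  obtain F d where x: "x = (F, d)" by (cases x)
  have c: "chain_above F xs" using Cons.prems x by simp
  have nz: "card F \<le> D + d" "degR (D + d) xs \<noteq> 0" using Cons.prems(2) x by (auto split: if_splits)
  show ?case
  proof (cases "H = F")
    case True then show ?thesis using x nz by (simp add: below_add below_single)
  next
    case False
    then have H: "H \<in> fst ` set xs" using Cons.prems x by auto
    then have "F \<subseteq> H" using chain_above_mem[OF c] by blast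
    then show ?thesis using Cons.IH[OF c nz(2) H] x by (simp add: below_add below_single)
  qed
qed simp

text \<open>Every size test holds with equality, so all lower indices are 0 and the degree is a
  product of signs.\<close>

lemma degR_diagonal:
  "chain_above G xs \<Longrightarrow> (\<And>H. H \<in> fst ` set xs \<Longrightarrow> D + below (list_mono xs) H = card H)
    \<Longrightarrow> degR D xs \<noteq> 0"
proof (induction xs arbitrary: G D)
  case (Cons x xs)
  obtain F d where x: "x = (F, d)" by (cases x)
  have c: "chain_above F xs" using Cons.prems x by simp
  have "below (list_mono xs) F = 0"
    using chain_above_mem[OF c] keys_list_mono[OF c] by (auto simp: below_def)
  then have F: "D + d = card F" using Cons.prems(2)[of F] x by (simp add: below_add below_single)
  have "degR (D + d) xs \<noteq> 0"
  proof (rule Cons.IH[OF c])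
    fix H assume H: "H \<in> fst ` set xs"
    then have "F \<subseteq> H" using chain_above_mem[OF c] by blast
    then show "D + d + below (list_mono xs) H = card H"
      using Cons.prems(2)[of H] H x by (simp add: below_add below_single)
  qed
  then show ?case using F x by simp
qed simp

lemma list_mono_exists:
  assumes "is_chain (Poly_Mapping.keys m)" "\<And>F. F \<in> Poly_Mapping.keys m \<Longrightarrow> G \<subset> F \<and> F \<subset> E" "G \<subset> E"
  shows "\<exists>xs. chain_above G xs \<and> list_mono xs = m"
  using assms
proof (induction "card (Poly_Mapping.keys m)" arbitrary: m G)
  case 0
  then have "m = 0" by simp
  then show ?case using 0 by (intro exI[of _ "[]"]) simp
next
  case (Suc n)
  have "Poly_Mapping.keys m \<noteq> {}" using Suc.hyps(2) by auto
  then obtain F where F: "F \<in> Poly_Mapping.keys m" "\<And>H. H \<in> Poly_Mapping.keys m \<Longrightarrow> H \<subseteq> F \<Longrightarrow> F = H"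
    using finite_has_minimal[of "Poly_Mapping.keys m"] by auto
  define m' where "m' = Poly_Mapping.update F 0 m"
  have keys: "Poly_Mapping.keys m' = Poly_Mapping.keys m - {F}" by (simp add: m'_def keys_update)
  have m: "m = Poly_Mapping.single F (Poly_Mapping.lookup m F) + m'"
    by (rule poly_mapping_eqI) (auto simp: lookup_add lookup_single when_def m'_def lookup_update)
  have "\<exists>xs. chain_above F xs \<and> list_mono xs = m'"
  proof (rule Suc.hyps(1))
    show "n = card (Poly_Mapping.keys m')" using Suc.hyps(2) F keys by simp
    show "is_chain (Poly_Mapping.keys m')" using Suc.prems(1) keys by (auto simp: is_chain_def)
    show "F \<subset> E" using Suc.prems(2) F by blast
    fix H assume H: "H \<in> Poly_Mapping.keys m'"
    then have "H \<subseteq> F \<or> F \<subseteq> H" using Suc.prems(1) F(1) keys by (auto simp: is_chain_def)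
    then show "F \<subset> H \<and> H \<subset> E" using H keys F(2)[of H] Suc.prems(2)[of H] by blast
  qed
  then obtain xs where xs: "chain_above F xs" "list_mono xs = m'" by blast
  have "0 < Poly_Mapping.lookup m F" using F(1) by (simp add: in_keys_iff)
  then show ?case using xs m Suc.prems(2)[OF F(1)]
    by (intro exI[of _ "(F, Poly_Mapping.lookup m F) # xs"]) simp
qed

lemma list_mono_inj:
  "chain_above G xs \<Longrightarrow> chain_above G' ys \<Longrightarrow> list_mono xs = list_mono ys \<Longrightarrow> xs = ys"
proof (induction xs arbitrary: ys G G')
  case Nil
  then show ?case using keys_list_mono[OF Nil(2)] by simp
next
  case (Cons x xs)
  have k: "fst ` set (x # xs) = fst ` set ys"
    using Cons.prems keys_list_mono by metis
  then obtain y zs where ys: "ys = y # zs" by (cases ys) auto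
  obtain F d where x: "x = (F, d)" by (cases x)
  obtain F' d' where y: "y = (F', d')" by (cases y)
  have c: "chain_above F xs" and c': "chain_above F' zs" using Cons.prems x y ys by auto
  have k: "insert F (fst ` set xs) = insert F' (fst ` set zs)" using k x y ys by simp
  have FF: "F = F'"
  proof (rule ccontr)
    assume n: "F \<noteq> F'"
    then have "F \<in> fst ` set zs" "F' \<in> fst ` set xs" using k by blast+
    then have "F' \<subset> F" "F \<subset> F'" using chain_above_mem[OF c', of F] chain_above_mem[OF c, of F'] by blast+
    then show False by blast
  qed
  have "F \<notin> Poly_Mapping.keys (list_mono xs)" "F \<notin> Poly_Mapping.keys (list_mono zs)"
    using chain_above_mem[OF c, of F] chain_above_mem[OF c', of F] FF keys_list_mono[OF c] keys_list_mono[OF c'] by blast+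
  then have "Poly_Mapping.lookup (list_mono xs) F = 0" "Poly_Mapping.lookup (list_mono zs) F = 0"
    by (auto simp: in_keys_iff)
  moreover have "Poly_Mapping.lookup (list_mono (x # xs)) F = Poly_Mapping.lookup (list_mono ys) F"
    using Cons.prems by simp
  ultimately have "d = d'" using x y ys FF by (simp add: lookup_add)
  then show ?case using Cons.IH[OF c c'] Cons.prems(3) x y ys FF by simp
qed

lemma ins_list_mono:
  "chain_above G xs \<Longrightarrow> H \<in> comparable_above G xs \<Longrightarrow>
     chain_above G (ins H xs) \<and> list_mono (ins H xs) = list_mono xs + Poly_Mapping.single H 1"
proof (induction xs arbitrary: G)
  case Nil then show ?case by simp
next
  case (Cons x xs)
  obtain F d where x: "x = (F, d)" by (cases x)
  have c: "chain_above F xs" "G \<subset> F" "0 < d" using Cons.prems x by auto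
  have H: "G \<subset> H" "H \<subset> E" "H \<subseteq> F \<or> F \<subseteq> H" using Cons.prems x by auto
  consider "H = F" | "H \<subset> F" | "F \<subset> H" using H(3) by blast
  then show ?case
  proof cases
    case 1
    then show ?thesis using c x by (simp add: single_add[symmetric] add_ac)
  next
    case 2
    then have "H \<noteq> F" by blast
    then show ?thesis using 2 c x H by (simp add: add_ac)
  next
    case 3
    then have n: "H \<noteq> F" "\<not> H \<subset> F" by blast+
    from 3 have "H \<in> comparable_above F xs" using Cons.prems x by auto
    then show ?thesis using Cons.IH[OF c(1)] n c x by (simp add: add_ac del: comparable_above.simps)
  qed
qed

text \<open>The list is unique by \<open>list_mono_inj\<close>. The value 0 off chains builds in the
  incomparability relations.\<close>

definition degmon :: "('a set \<Rightarrow>\<^sub>0 nat) \<Rightarrow> rat" where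
  "degmon m = (if \<exists>xs. chain_above {} xs \<and> list_mono xs = m
     then degR 0 (THE xs. chain_above {} xs \<and> list_mono xs = m) else 0)"

lemma degmon_list_mono: "chain_above {} xs \<Longrightarrow> degmon (list_mono xs) = degR 0 xs"
proof -
  assume xs: "chain_above {} xs"
  then have "(THE ys. chain_above {} ys \<and> list_mono ys = list_mono xs) = xs"
    using list_mono_inj by (intro the_equality) blast+
  moreover have "\<exists>ys. chain_above {} ys \<and> list_mono ys = list_mono xs" using xs by blast
  ultimately show ?thesis by (simp only: degmon_def if_True)
qed

lemma chain_above_is_chain: "chain_above G xs \<Longrightarrow> is_chain (fst ` set xs)"
proof (induction xs arbitrary: G)
  case (Cons x xs)
  obtain F d where x: "x = (F, d)" by (cases x)
  have c: "chain_above F xs" using Cons.prems x by simp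
  have "F \<subseteq> H" if "H \<in> fst ` set xs" for H
    using chain_above_mem[OF c that] by blast
  then have "\<forall>H\<in>fst ` set xs. F \<subseteq> H" by blast
  moreover have "fst ` set (x # xs) = insert F (fst ` set xs)" using x by simp
  ultimately show ?case using Cons.IH[OF c] unfolding is_chain_def by (metis insert_iff order_refl)
qed (simp add: is_chain_def)

lemma degmon_nonzero:
  assumes "degmon m \<noteq> 0"
  shows "is_chain (Poly_Mapping.keys m)" "F \<in> Poly_Mapping.keys m \<Longrightarrow> F \<noteq> {} \<and> F \<subset> E \<and> card F \<le> below m F"
proof -
  obtain xs where xs: "chain_above {} xs" "list_mono xs = m" using assms by (auto simp: degmon_def split: if_splits)
  have k: "Poly_Mapping.keys m = fst ` set xs" using keys_list_mono xs by blast
  show "is_chain (Poly_Mapping.keys m)" using chain_above_is_chain xs k by simp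
  assume F: "F \<in> Poly_Mapping.keys m"
  have "degR 0 xs \<noteq> 0" using degmon_list_mono[OF xs(1)] xs(2) assms by simp
  then show "F \<noteq> {} \<and> F \<subset> E \<and> card F \<le> below m F"
    using degR_nonzero[OF xs(1), of 0 F] chain_above_mem[OF xs(1), of F] F k xs by auto
qed

lemma degmon_diagonal:
  assumes "is_chain (Poly_Mapping.keys m)" "E \<noteq> {}"
    "\<And>F. F \<in> Poly_Mapping.keys m \<Longrightarrow> F \<noteq> {} \<and> F \<subset> E \<and> below m F = card F"
  shows "degmon m \<noteq> 0"
proof -
  obtain xs where xs: "chain_above {} xs" "list_mono xs = m"
    using list_mono_exists[of m "{}"] assms by blast
  have k: "Poly_Mapping.keys m = fst ` set xs" using keys_list_mono xs by blast
  have "degR 0 xs \<noteq> 0" by (rule degR_diagonal[OF xs(1)]) (use xs k assms(3) in auto)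
  then show ?thesis using degmon_list_mono xs by metis
qed

text \<open>Only the H comparable with the support contribute, and for them this is
  \<open>sum_insert_containing\<close> with G = {} and D = 0. If m is not a chain monomial, neither
  is any multiple of it.\<close>

lemma degmon_sum:
  assumes "i \<in> E" "mon_deg m + 2 \<le> card E"
  shows "(\<Sum>H | H \<subset> E \<and> i \<in> H. degmon (m + Poly_Mapping.single H 1)) = degmon m"
proof (cases "\<exists>xs. chain_above {} xs \<and> list_mono xs = m")
  case True
  then obtain xs where xs: "chain_above {} xs" "list_mono xs = m" by blast
  have k: "Poly_Mapping.keys m = fst ` set xs" using keys_list_mono xs by blast
  have "(\<Sum>H | H \<subset> E \<and> i \<in> H. degmon (m + Poly_Mapping.single H 1)) =
     (\<Sum>H\<in>{H\<in>comparable_above {} xs. i \<in> H}. degmon (m + Poly_Mapping.single H 1))"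
  proof (rule sum.mono_neutral_right)
    show "finite {H. H \<subset> E \<and> i \<in> H}" by (rule finite_subset[of _ "Pow E"]) (use finE in auto)
    show "\<forall>H\<in>{H. H \<subset> E \<and> i \<in> H} - {H \<in> comparable_above {} xs. i \<in> H}. degmon (m + Poly_Mapping.single H 1) = 0"
    proof
      fix H assume H: "H \<in> {H. H \<subset> E \<and> i \<in> H} - {H \<in> comparable_above {} xs. i \<in> H}"
      show "degmon (m + Poly_Mapping.single H 1) = 0"
      proof (rule ccontr)
        assume "degmon (m + Poly_Mapping.single H 1) \<noteq> 0"
        then have "is_chain (Poly_Mapping.keys (m + Poly_Mapping.single H 1))" by (rule degmon_nonzero)
        then have "\<forall>F\<in>fst ` set xs. H \<subseteq> F \<or> F \<subseteq> H" using k by (simp add: keys_add_nat is_chain_def)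
        then show False using H by auto
      qed
    qed
  qed auto
  also have "\<dots> = (\<Sum>H\<in>{H\<in>comparable_above {} xs. i \<in> H}. degC {} 0 (ins H xs))"
  proof (rule sum.cong[OF refl])
    fix H assume "H \<in> {H\<in>comparable_above {} xs. i \<in> H}"
    then have "chain_above {} (ins H xs)" "list_mono (ins H xs) = m + Poly_Mapping.single H 1"
      using ins_list_mono[OF xs(1)] xs by blast+
    then show "degmon (m + Poly_Mapping.single H 1) = degC {} 0 (ins H xs)"
      using degmon_list_mono[of "ins H xs"] by (simp add: degC_def)
  qed
  also have "\<dots> = degC {} 0 xs"
    using assms xs by (intro sum_insert_containing) (auto simp flip: mon_deg_list_mono)
  finally show ?thesis using degmon_list_mono[OF xs(1)] xs by (simp add: degC_def)
next
  case False
  have "degmon (m + Poly_Mapping.single H 1) = 0" for H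
  proof (rule ccontr)
    assume nz: "degmon (m + Poly_Mapping.single H 1) \<noteq> 0"
    have "is_chain (Poly_Mapping.keys m)" "\<And>F. F \<in> Poly_Mapping.keys m \<Longrightarrow> {} \<subset> F \<and> F \<subset> E"
      using degmon_nonzero[OF nz] by (auto simp: keys_add_nat is_chain_def)
    then show False using list_mono_exists[of m "{}"] assms(1) False by blast
  qed
  moreover have "degmon m = 0" unfolding degmon_def using False by (simp only: if_False)
  ultimately show ?thesis by simp
qed

end

subsection \<open>Linear independence of the Feichtner--Yuzvinsky monomials\<close>

lemma mpoly_eq_sum_single:
  "(p :: 'v mpoly) = (\<Sum>m\<in>Poly_Mapping.keys p. Poly_Mapping.single m (Poly_Mapping.lookup p m))"
proof (rule poly_mapping_eqI)
  fix x
  have "(\<Sum>m\<in>Poly_Mapping.keys p. Poly_Mapping.lookup (Poly_Mapping.single m (Poly_Mapping.lookup p m)) x) =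
    (\<Sum>m\<in>Poly_Mapping.keys p. if m = x then Poly_Mapping.lookup p x else 0)"
    by (rule sum.cong) (auto simp: lookup_single when_def)
  then show "Poly_Mapping.lookup p x =
    Poly_Mapping.lookup (\<Sum>m\<in>Poly_Mapping.keys p. Poly_Mapping.single m (Poly_Mapping.lookup p m)) x"
    by (auto simp: lookup_sum in_keys_iff)
qed

lemma qscale_eq: "qscale c p = Poly_Mapping.single 0 c * p"
  unfolding qscale_def by (rule mult_map_scale_conv_mult)

lemma single_mult_mvar:
  "Poly_Mapping.single m c * mvar F = Poly_Mapping.single (m + Poly_Mapping.single F 1) c"
  by (simp add: mvar_def mult_single)

text \<open>For a chain this is the predecessor F' of F, or {} if there is none.\<close>

definition low :: "('a set \<Rightarrow>\<^sub>0 nat) \<Rightarrow> 'a set \<Rightarrow> 'a set" where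
  "low m F = \<Union>{G \<in> Poly_Mapping.keys m. G \<subset> F}"

text \<open>Complementary exponents: in the product of x^m with its dual, each F carries exactly the
  gap |F| - |F'|, so every partial degree equals |F| and \<open>degR_diagonal\<close>
  applies.\<close>

definition dual :: "('a set \<Rightarrow>\<^sub>0 nat) \<Rightarrow> 'a set \<Rightarrow>\<^sub>0 nat" where
  "dual m = Poly_Mapping.mapp (\<lambda>F d. card F - card (low m F) - d) m"

lemma is_chain_subset: "is_chain C \<Longrightarrow> D \<subseteq> C \<Longrightarrow> is_chain D"
  by (auto simp: is_chain_def)

text \<open>The union of a chain is partitioned by the differences of consecutive members.\<close>

lemma sum_card_chain_gaps:
  assumes "finite C" "is_chain C" "\<And>F. F \<in> C \<Longrightarrow> finite F"
  shows "(\<Sum>F\<in>C. card F - card (\<Union>{G\<in>C. G \<subset> F})) = card (\<Union>C)"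
proof -
  let ?l = "\<lambda>F. \<Union>{G\<in>C. G \<subset> F}"
  have "card (\<Union>F\<in>C. F - ?l F) = (\<Sum>F\<in>C. card (F - ?l F))"
  proof (rule card_UN_disjoint)
    show "\<forall>i\<in>C. \<forall>j\<in>C. i \<noteq> j \<longrightarrow> (i - ?l i) \<inter> (j - ?l j) = {}"
    proof (intro ballI impI)
      fix F G assume FG: "F \<in> C" "G \<in> C" "F \<noteq> G"
      then have "F \<subset> G \<or> G \<subset> F" using assms(2) by (auto simp: is_chain_def)
      then show "(F - ?l F) \<inter> (G - ?l G) = {}" using FG by blast
    qed
  qed (use assms in auto)
  also have "(\<Union>F\<in>C. F - ?l F) = \<Union>C"
  proof (rule equalityI)
    show "\<Union>C \<subseteq> (\<Union>F\<in>C. F - ?l F)"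
    proof
      fix x assume "x \<in> \<Union>C"
      then have "{F\<in>C. x \<in> F} \<noteq> {}" by auto
      then obtain F where F: "F \<in> C" "x \<in> F" "\<And>G. G \<in> C \<Longrightarrow> x \<in> G \<Longrightarrow> G \<subseteq> F \<Longrightarrow> F = G"
        using finite_has_minimal[of "{F\<in>C. x \<in> F}"] assms(1) by auto
      then have "x \<notin> ?l F" by blast
      then show "x \<in> (\<Union>F\<in>C. F - ?l F)" using F by blast
    qed
  qed auto
  also have "(\<Sum>F\<in>C. card (F - ?l F)) = (\<Sum>F\<in>C. card F - card (?l F))"
    by (rule sum.cong) (use assms in \<open>auto intro!: card_Diff_subset intro: finite_subset\<close>)
  finally show ?thesis ..
qed

section \<open>The Chow ring of the uniform matroid and its candidate basis\<close>

locale uniform_chow = finite_ground +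
  fixes k :: nat
  assumes k1: "1 \<le> k" and kE: "k \<le> card E"
begin

definition V :: "'a set set" where
  "V = {F. F \<subseteq> E \<and> F \<noteq> {} \<and> card F < k}"

definition lin :: "'a \<Rightarrow> 'a set mpoly" where
  "lin i = (\<Sum>F\<in>{F\<in>V. i \<in> F}. mvar F)"

definition gens :: "'a set mpoly set" where
  "gens = {mvar F * mvar G | F G. F \<in> V \<and> G \<in> V \<and> \<not> F \<subseteq> G \<and> \<not> G \<subseteq> F}
    \<union> {lin i - lin j | i j. i \<in> E \<and> j \<in> E}"

definition FY :: "('a set \<Rightarrow>\<^sub>0 nat) set" where
  "FY = {m. Poly_Mapping.keys m \<subseteq> V \<and> is_chain (Poly_Mapping.keys m) \<and>
     (\<forall>F\<in>Poly_Mapping.keys m. Poly_Mapping.lookup m F + card (low m F) < card F)}"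

text \<open>The pair \<open>(m, e)\<close> encodes the monomial \<open>x\<^sup>m (-x\<^sub>E)\<^sup>e\<close>, where \<open>x\<^sub>E = - lin i\<close> for every \<open>i \<in> E\<close>.\<close>

definition FYE :: "nat \<Rightarrow> (('a set \<Rightarrow>\<^sub>0 nat) \<times> nat) set" where
  "FYE j = {(m, e). m \<in> FY \<and> e + card (\<Union>(Poly_Mapping.keys m)) < k \<and> mon_deg m + e = j}"

definition i0 :: 'a where "i0 = (SOME i. i \<in> E)"

definition fy_elem :: "('a set \<Rightarrow>\<^sub>0 nat) \<times> nat \<Rightarrow> 'a set mpoly" where
  "fy_elem = (\<lambda>(m, e). Poly_Mapping.single m 1 * lin i0 ^ e)"

lemma finite_V: "finite V"
  unfolding V_def by (rule finite_subset[of _ "Pow E"]) (use finE in auto)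

lemma V_finite: "F \<in> V \<Longrightarrow> finite F"
  unfolding V_def using finE finite_subset by auto

lemma V_psubset: "F \<in> V \<Longrightarrow> F \<subset> E"
  unfolding V_def using kE by auto

lemma E_ne: "E \<noteq> {}"
  using k1 kE by auto

lemma i0_E: "i0 \<in> E"
  unfolding i0_def using E_ne by (simp add: some_in_eq)

text \<open>The rank enters only here, through the restriction to the top degree k - 1 of the Chow
  ring.\<close>

definition degmap :: "'a set mpoly \<Rightarrow> rat" where
  "degmap p = (\<Sum>m\<in>Poly_Mapping.keys p. if mon_deg m + 1 = k then Poly_Mapping.lookup p m * degmon m else 0)"

lemma degmap_superset:
  "finite S \<Longrightarrow> Poly_Mapping.keys p \<subseteq> S \<Longrightarrow>
   degmap p = (\<Sum>m\<in>S. if mon_deg m + 1 = k then Poly_Mapping.lookup p m * degmon m else 0)"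
  unfolding degmap_def by (rule sum.mono_neutral_left) (auto simp: in_keys_iff)

lemma degmap_0 [simp]: "degmap 0 = 0"
  by (simp add: degmap_def)

lemma degmap_add: "degmap (p + q) = degmap p + degmap q"
proof -
  let ?S = "Poly_Mapping.keys p \<union> Poly_Mapping.keys q"
  have "Poly_Mapping.keys (p + q) \<subseteq> ?S" by (rule Poly_Mapping.keys_add)
  then have "degmap (p + q) = (\<Sum>m\<in>?S. if mon_deg m + 1 = k then Poly_Mapping.lookup (p + q) m * degmon m else 0)"
    by (intro degmap_superset) auto
  moreover have "degmap p = (\<Sum>m\<in>?S. if mon_deg m + 1 = k then Poly_Mapping.lookup p m * degmon m else 0)"
    "degmap q = (\<Sum>m\<in>?S. if mon_deg m + 1 = k then Poly_Mapping.lookup q m * degmon m else 0)"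
    by (rule degmap_superset; simp)+
  ultimately show ?thesis
    by (simp add: sum.distrib[symmetric] lookup_add algebra_simps if_distrib cong: if_cong)
qed

lemma degmap_sum: "degmap (\<Sum>x\<in>A. f x) = (\<Sum>x\<in>A. degmap (f x))"
  by (induction A rule: infinite_finite_induct) (auto simp: degmap_add)

lemma degmap_single:
  "degmap (Poly_Mapping.single m c) = (if mon_deg m + 1 = k then c * degmon m else 0)"
  by (subst degmap_superset[of "{m}"]) auto

lemma degmap_uminus: "degmap (- p) = - degmap p"
  using degmap_add[of p "-p"] by simp

lemma degmap_diff: "degmap (p - q) = degmap p - degmap q"
  using degmap_add[of p "-q"] by (simp add: degmap_uminus)

text \<open>Sets of size at least \<open>k\<close> may be left out: they have degree zero in total degree below \<open>k\<close>.\<close>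

lemma degmon_sum_V:
  assumes "i \<in> E" "mon_deg m + 2 \<le> k"
  shows "(\<Sum>F\<in>{F\<in>V. i \<in> F}. degmon (m + Poly_Mapping.single F 1)) = degmon m"
proof -
  have "(\<Sum>H | H \<subset> E \<and> i \<in> H. degmon (m + Poly_Mapping.single H 1)) =
    (\<Sum>F\<in>{F\<in>V. i \<in> F}. degmon (m + Poly_Mapping.single F 1))"
  proof (rule sum.mono_neutral_right)
    show "finite {H. H \<subset> E \<and> i \<in> H}" by (rule finite_subset[of _ "Pow E"]) (use finE in auto)
    show "{F \<in> V. i \<in> F} \<subseteq> {H. H \<subset> E \<and> i \<in> H}" using V_psubset by blast
    show "\<forall>F\<in>{H. H \<subset> E \<and> i \<in> H} - {F \<in> V. i \<in> F}. degmon (m + Poly_Mapping.single F 1) = 0"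
    proof
      fix F assume F: "F \<in> {H. H \<subset> E \<and> i \<in> H} - {F \<in> V. i \<in> F}"
      show "degmon (m + Poly_Mapping.single F 1) = 0"
      proof (rule ccontr)
        assume nz: "degmon (m + Poly_Mapping.single F 1) \<noteq> 0"
        have "card F \<le> below (m + Poly_Mapping.single F 1) F"
          using degmon_nonzero(2)[OF nz, of F] by (simp add: keys_add_nat)
        also have "\<dots> \<le> mon_deg (m + Poly_Mapping.single F 1)" by (rule below_le_mon_deg)
        also have "\<dots> < k" using assms by (simp add: mon_deg_add)
        finally show False using F by (auto simp: V_def)
      qed
    qed
  qed
  then show ?thesis using degmon_sum[OF assms(1), of m] assms(2) kE by simp
qed

lemma degmap_single_lin:
  assumes "i \<in> E"
  shows "degmap (Poly_Mapping.single m c * lin i) = (if mon_deg m + 2 = k then c * degmon m else 0)"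
proof -
  have "degmap (Poly_Mapping.single m c * lin i) =
     (\<Sum>F\<in>{F\<in>V. i \<in> F}. if mon_deg m + 2 = k then c * degmon (m + Poly_Mapping.single F 1) else 0)"
    unfolding lin_def sum_distrib_left degmap_sum single_mult_mvar degmap_single
    by (simp add: mon_deg_add)
  also have "\<dots> = (if mon_deg m + 2 = k then c * degmon m else 0)"
    using degmon_sum_V[OF assms, of m] by (auto simp flip: sum_distrib_left)
  finally show ?thesis .
qed

text \<open>Expand one factor \<open>lin i\<close>; the induction hypothesis treats the others on
  each x^m x_F, and \<open>degmon_sum_V\<close> adds up the results. A power of alpha thus only
  fills up the degree.\<close>

lemma degmap_single_lin_power:
  assumes "i \<in> E" "mon_deg m + e + 1 = k"
  shows "degmap (Poly_Mapping.single m 1 * lin i ^ e) = degmon m"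
  using assms(2)
proof (induction e arbitrary: m)
  case 0 then show ?case by (simp add: degmap_single)
next
  case (Suc e)
  have "degmap (Poly_Mapping.single m 1 * lin i ^ Suc e) =
     degmap (\<Sum>F\<in>{F\<in>V. i \<in> F}. Poly_Mapping.single (m + Poly_Mapping.single F 1) 1 * lin i ^ e)"
    unfolding power_Suc mult.assoc[symmetric]
    by (subst (1) lin_def) (simp add: sum_distrib_left sum_distrib_right single_mult_mvar)
  also have "\<dots> = (\<Sum>F\<in>{F\<in>V. i \<in> F}. degmon (m + Poly_Mapping.single F 1))"
    unfolding degmap_sum by (rule sum.cong[OF refl], rule Suc.IH) (use Suc.prems in \<open>simp add: mon_deg_add\<close>)
  also have "\<dots> = degmon m" using degmon_sum_V[OF assms(1)] Suc.prems by simp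
  finally show ?case .
qed

lemma degmap_mult_gen:
  assumes "g \<in> gens"
  shows "degmap (s * g) = 0"
proof -
  have single: "degmap (Poly_Mapping.single m c * g) = 0" for m c
  proof -
    consider F G where "g = mvar F * mvar G" "\<not> F \<subseteq> G" "\<not> G \<subseteq> F"
      | i j where "g = lin i - lin j" "i \<in> E" "j \<in> E"
      using assms by (auto simp: gens_def)
    then show ?thesis
    proof cases
      case 1
      let ?m = "m + Poly_Mapping.single F 1 + Poly_Mapping.single G 1"
      have "\<not> is_chain (Poly_Mapping.keys ?m)"
        using 1 by (auto simp: is_chain_def keys_add_nat)
      then have "degmon ?m = 0" using degmon_nonzero(1) by blast
      moreover have "Poly_Mapping.single m c * g = Poly_Mapping.single ?m c"
        using 1 by (simp add: mult.assoc[symmetric] single_mult_mvar)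
      ultimately show ?thesis by (simp only: degmap_single) simp
    next
      case 2
      then show ?thesis by (simp add: right_diff_distrib degmap_diff degmap_single_lin)
    qed
  qed
  show ?thesis
    by (subst mpoly_eq_sum_single[of s]) (simp add: sum_distrib_right degmap_sum single)
qed

text \<open>The multiplier \<open>s\<close> carries the induction through the closure under
  multiplication, and it makes \<open>degmap\<close> of a product a pairing on the quotient.\<close>

lemma degmap_ideal: "p \<in> ideal_in V gens \<Longrightarrow> degmap (s * p) = 0"
proof (induction arbitrary: s rule: ideal_in.induct)
  case (gen g) then show ?case by (rule degmap_mult_gen)
next
  case (mult a r) then show ?case by (metis mult.assoc)
qed (simp_all add: distrib_left degmap_add)

section \<open>Complementary monomials and the triangular pairing\<close>

lemma FY_D:
  assumes "m \<in> FY"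
  shows "Poly_Mapping.keys m \<subseteq> V" "is_chain (Poly_Mapping.keys m)"
    "F \<in> Poly_Mapping.keys m \<Longrightarrow> Poly_Mapping.lookup m F + card (low m F) < card F"
  using assms by (auto simp: FY_def)

lemma lookup_dual:
  "Poly_Mapping.lookup (dual m) F =
    (if F \<in> Poly_Mapping.keys m then card F - card (low m F) - Poly_Mapping.lookup m F else 0)"
  by (simp add: dual_def lookup_mapp when_def)

lemma keys_dual: "m \<in> FY \<Longrightarrow> Poly_Mapping.keys (dual m) = Poly_Mapping.keys m"
proof (rule set_eqI)
  fix F assume "m \<in> FY"
  then show "F \<in> Poly_Mapping.keys (dual m) \<longleftrightarrow> F \<in> Poly_Mapping.keys m"
    using FY_D(3)[of m F] by (auto simp: in_keys_iff[of _ "dual m"] lookup_dual)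
qed

text \<open>At each F the two exponents add up to the gap |F| - |F'|. As C is closed downwards, its
  gaps are those of the whole chain, and they sum to the size of its top. Total and partial degrees
  are both obtained from this.\<close>

lemma sum_gaps_FY:
  assumes "m \<in> FY" "C \<subseteq> Poly_Mapping.keys m"
    "\<And>F G. F \<in> C \<Longrightarrow> G \<in> Poly_Mapping.keys m \<Longrightarrow> G \<subset> F \<Longrightarrow> G \<in> C"
  shows "(\<Sum>F\<in>C. Poly_Mapping.lookup m F + Poly_Mapping.lookup (dual m) F) = card (\<Union>C)"
proof -
  have "(\<Sum>F\<in>C. Poly_Mapping.lookup m F + Poly_Mapping.lookup (dual m) F) =
     (\<Sum>F\<in>C. card F - card (\<Union>{G\<in>C. G \<subset> F}))"
  proof (rule sum.cong[OF refl])
    fix F assume F: "F \<in> C"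
    then have "{G\<in>C. G \<subset> F} = {G \<in> Poly_Mapping.keys m. G \<subset> F}" using assms by blast
    then show "Poly_Mapping.lookup m F + Poly_Mapping.lookup (dual m) F = card F - card (\<Union>{G\<in>C. G \<subset> F})"
      using FY_D(3)[OF assms(1), of F] F assms(2) by (auto simp: lookup_dual low_def[symmetric])
  qed
  also have "\<dots> = card (\<Union>C)"
  proof (rule sum_card_chain_gaps)
    show "finite C" using finite_subset[OF assms(2)] by simp
    show "is_chain C" using FY_D(2)[OF assms(1)] assms(2) is_chain_subset by blast
    show "finite F" if "F \<in> C" for F using that assms(2) FY_D(1)[OF assms(1)] V_finite by blast
  qed
  finally show ?thesis .
qed

lemma mon_deg_dual: "m \<in> FY \<Longrightarrow> mon_deg m + mon_deg (dual m) = card (\<Union>(Poly_Mapping.keys m))"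
  using sum_gaps_FY[of m "Poly_Mapping.keys m"] by (simp add: mon_deg_def keys_dual sum.distrib)

lemma degmon_dual_self:
  assumes "m \<in> FY" shows "degmon (m + dual m) \<noteq> 0"
proof (rule degmon_diagonal)
  have k: "Poly_Mapping.keys (m + dual m) = Poly_Mapping.keys m"
    using keys_dual[OF assms] by (simp add: keys_add_nat)
  show "is_chain (Poly_Mapping.keys (m + dual m))" using k FY_D(2)[OF assms] by simp
  show "E \<noteq> {}" by (rule E_ne)
  fix F assume "F \<in> Poly_Mapping.keys (m + dual m)"
  then have F: "F \<in> Poly_Mapping.keys m" using k by simp
  have "below (m + dual m) F = card (\<Union>{G \<in> Poly_Mapping.keys m. G \<subseteq> F})"
    unfolding below_def k lookup_add by (rule sum_gaps_FY) (use assms in auto)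
  also have "\<Union>{G \<in> Poly_Mapping.keys m. G \<subseteq> F} = F" using F by blast
  finally show "F \<noteq> {} \<and> F \<subset> E \<and> below (m + dual m) F = card F"
    using F FY_D(1)[OF assms] V_psubset by (auto simp: V_def)
qed

text \<open>Lexicographic comparison from the bottom, with the smaller exponent still positive.
  Positivity and the strict inequality put both deciding flats of a composition into the support of
  the middle monomial, where they are comparable; this gives transitivity.\<close>

definition precedes :: "('a set \<Rightarrow>\<^sub>0 nat) \<Rightarrow> ('a set \<Rightarrow>\<^sub>0 nat) \<Rightarrow> bool" where
  "precedes m2 m1 \<longleftrightarrow> (\<exists>F\<in>Poly_Mapping.keys m2. Poly_Mapping.lookup m2 F < Poly_Mapping.lookup m1 F
     \<and> (\<forall>G. G \<subset> F \<longrightarrow> Poly_Mapping.lookup m1 G = Poly_Mapping.lookup m2 G))"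

lemma precedes_trans:
  assumes "precedes m1 m2" "precedes m2 m3" "is_chain (Poly_Mapping.keys m2)"
  shows "precedes m1 m3"
proof -
  obtain F where F: "F \<in> Poly_Mapping.keys m1" "Poly_Mapping.lookup m1 F < Poly_Mapping.lookup m2 F"
    "\<And>G. G \<subset> F \<Longrightarrow> Poly_Mapping.lookup m2 G = Poly_Mapping.lookup m1 G"
    using assms(1) unfolding precedes_def by blast
  obtain H where H: "H \<in> Poly_Mapping.keys m2" "Poly_Mapping.lookup m2 H < Poly_Mapping.lookup m3 H"
    "\<And>G. G \<subset> H \<Longrightarrow> Poly_Mapping.lookup m3 G = Poly_Mapping.lookup m2 G"
    using assms(2) unfolding precedes_def by blast
  have "F \<in> Poly_Mapping.keys m2" using F(2) by (simp add: in_keys_iff)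
  then consider "F = H" | "F \<subset> H" | "H \<subset> F" using assms(3) H(1) unfolding is_chain_def by blast
  then show ?thesis
  proof cases
    case 1
    then show ?thesis unfolding precedes_def using F H by (intro bexI[of _ F]) auto
  next
    case 2
    then have "\<And>G. G \<subset> F \<Longrightarrow> G \<subset> H" by blast
    then show ?thesis unfolding precedes_def using F H 2 by (intro bexI[of _ F]) auto
  next
    case 3
    then have "\<And>G. G \<subset> H \<Longrightarrow> G \<subset> F" by blast
    moreover have "H \<in> Poly_Mapping.keys m1" using H(1) F(3)[OF 3] by (simp add: in_keys_iff)
    ultimately show ?thesis unfolding precedes_def using F H 3 by (intro bexI[of _ H]) auto
  qed
qed

lemma precedes_asym:
  assumes "precedes m1 m2" "precedes m2 m1" "is_chain (Poly_Mapping.keys m2)"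
  shows False
  using precedes_trans[OF assms] unfolding precedes_def by blast

text \<open>The inequality \<open>card F \<le> below (m1 + dual m2) F\<close> is evaluated at a minimal \<open>F\<close> where \<open>m1\<close> and \<open>m2\<close> differ.\<close>

lemma degmon_dual_triangular:
  assumes "m1 \<in> FY" "m2 \<in> FY" "degmon (m1 + dual m2) \<noteq> 0" "m1 \<noteq> m2"
  shows "precedes m2 m1"
proof -
  let ?l = Poly_Mapping.lookup and ?k = Poly_Mapping.keys
  have kk: "?k (m1 + dual m2) = ?k m1 \<union> ?k m2" using keys_dual[OF assms(2)] by (simp add: keys_add_nat)
  let ?D = "{F. ?l m1 F \<noteq> ?l m2 F}"
  have "?D \<noteq> {}"
  proof
    assume "?D = {}"
    then have "m1 = m2" by (intro poly_mapping_eqI) auto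
    then show False using assms(4) by simp
  qed
  moreover have "?D \<subseteq> ?k m1 \<union> ?k m2" by (auto simp: in_keys_iff)
  then have "finite ?D" by (rule finite_subset) simp
  ultimately obtain F where F: "F \<in> ?D" "\<And>G. G \<in> ?D \<Longrightarrow> G \<subseteq> F \<Longrightarrow> F = G"
    using finite_has_minimal[of ?D] by auto
  have eq: "?l m1 G = ?l m2 G" if "G \<subset> F" for G using F(2)[of G] that by blast
  have Fk: "F \<in> ?k m1 \<union> ?k m2" using F(1) by (auto simp: in_keys_iff)
  have finF: "finite F" using Fk FY_D(1)[OF assms(1)] FY_D(1)[OF assms(2)] V_finite by blast
  have low: "low m1 F = low m2 F" unfolding low_def using eq by (metis (lifting) in_keys_iff)
  define C where "C = {G \<in> ?k m2. G \<subset> F}"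
  have C1: "{G \<in> ?k m1 \<union> ?k m2. G \<subset> F} = C" unfolding C_def using eq by (metis (lifting) Un_iff in_keys_iff)
  have CF: "finite C" "F \<notin> C" "\<Union>C = low m2 F" by (auto simp: C_def low_def)
  have "card F \<le> below (m1 + dual m2) F"
    using degmon_nonzero(2)[OF assms(3), of F] Fk kk by simp
  also have "\<dots> = (\<Sum>G\<in>insert F C. ?l (m1 + dual m2) G)"
  proof -
    have "{G \<in> ?k m1 \<union> ?k m2. G \<subseteq> F} = insert F C" using C1 Fk by blast
    then show ?thesis unfolding below_def kk by simp
  qed
  also have "\<dots> = ?l m1 F + ?l (dual m2) F + (\<Sum>G\<in>C. ?l m2 G + ?l (dual m2) G)"
    using CF eq by (simp add: lookup_add C_def cong: sum.cong_simp)
  also have "(\<Sum>G\<in>C. ?l m2 G + ?l (dual m2) G) = card (low m2 F)"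
    unfolding CF(3)[symmetric] by (rule sum_gaps_FY) (use assms C_def in auto)
  finally have le: "card F \<le> ?l m1 F + ?l (dual m2) F + card (low m2 F)" .
  show ?thesis
  proof (cases "F \<in> ?k m2")
    case True
    then have "?l m2 F < ?l m1 F"
      using le FY_D(3)[OF assms(2) True] F(1) by (simp add: lookup_dual)
    then show ?thesis unfolding precedes_def using True eq by blast
  next
    \<comment> \<open>Here the dual contributes nothing at F, so the inequality would force the
      exponent of F in m1 up to the full gap, which \<open>FY\<close> forbids.\<close>
    case False
    then have "F \<in> ?k m1" using Fk by blast
    then show ?thesis using le FY_D(3)[OF assms(1), of F] False low by (simp add: lookup_dual)
  qed
qed

lemma finite_monomials: "finite {m. Poly_Mapping.keys m \<subseteq> V \<and> mon_deg m \<le> j}"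
proof -
  have "Poly_Mapping.lookup ` {m. Poly_Mapping.keys m \<subseteq> V \<and> mon_deg m \<le> j}
     \<subseteq> {f. \<forall>x. (x \<in> V \<longrightarrow> f x \<in> {..j}) \<and> (x \<notin> V \<longrightarrow> f x = 0)}"
  proof clarsimp
    fix m :: "'a set \<Rightarrow>\<^sub>0 nat" and x
    assume m: "Poly_Mapping.keys m \<subseteq> V" "mon_deg m \<le> j"
    have "Poly_Mapping.lookup m x \<le> mon_deg m"
    proof (cases "x \<in> Poly_Mapping.keys m")
      case True then show ?thesis unfolding mon_deg_def by (intro member_le_sum) auto
    qed (simp add: in_keys_iff)
    then show "(x \<in> V \<longrightarrow> Poly_Mapping.lookup m x \<le> j) \<and> (x \<notin> V \<longrightarrow> Poly_Mapping.lookup m x = 0)"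
      using m by (auto simp: in_keys_iff)
  qed
  then have "finite (Poly_Mapping.lookup ` {m. Poly_Mapping.keys m \<subseteq> V \<and> mon_deg m \<le> j})"
    by (rule finite_subset) (rule finite_set_of_finite_funs; simp add: finite_V)
  then show ?thesis by (rule finite_imageD) (auto intro!: inj_onI poly_mapping_eqI)
qed

lemma finite_FYE: "finite (FYE j)"
proof (rule finite_subset)
  show "FYE j \<subseteq> {m. Poly_Mapping.keys m \<subseteq> V \<and> mon_deg m \<le> j} \<times> {..j}"
    by (auto simp: FYE_def dest: FY_D)
qed (simp add: finite_monomials)

text \<open>Among the terms with nonzero coefficient choose one whose monomial precedes no other,
  and pair the relation with its complement. By triangularity all other terms give 0, while the
  chosen one has nonzero degree.\<close>

lemma fy_elem_independent:
  assumes "(\<Sum>x\<in>FYE j. qscale (c x) (fy_elem x)) \<in> ideal_in V gens"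
  shows "\<forall>x\<in>FYE j. c x = 0"
proof (rule ccontr)
  assume "\<not> (\<forall>x\<in>FYE j. c x = 0)"
  define S where "S = {x\<in>FYE j. c x \<noteq> 0}"
  have "S \<noteq> {}" "finite S" using \<open>\<not> _\<close> finite_FYE by (auto simp: S_def)
  moreover have chain: "is_chain (Poly_Mapping.keys (fst x))" if "x \<in> S" for x
    using that FY_D(2) by (auto simp: S_def FYE_def)
  have "transp_on S (\<lambda>x y. precedes (fst x) (fst y))"
    by (rule transp_onI) (use precedes_trans chain in blast)
  moreover have "asymp_on S (\<lambda>x y. precedes (fst x) (fst y))"
    by (rule asymp_onI) (use precedes_asym chain in blast)
  ultimately obtain x where x: "x \<in> S" "\<And>y. y \<in> S \<Longrightarrow> y \<noteq> x \<Longrightarrow> \<not> precedes (fst x) (fst y)"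
    using Finite_Set.bex_max_element[of S "\<lambda>x y. precedes (fst x) (fst y)"] by blast
  obtain m e where me: "x = (m, e)" by (cases x)
  have m: "m \<in> FY" "e + card (\<Union>(Poly_Mapping.keys m)) < k" "mon_deg m + e = j"
    using x(1) me by (auto simp: S_def FYE_def)
  \<comment> \<open>Since m and its dual together have degree |top m|, this exponent completes the
    total degree to k - 1.\<close>
  let ?e' = "k - 1 - card (\<Union>(Poly_Mapping.keys m)) - e"
  let ?b = "Poly_Mapping.single (dual m) 1 * lin i0 ^ ?e'"
  have pair: "degmap (?b * qscale (c y) (fy_elem y)) = c y * degmon (fst y + dual m)" if "y \<in> FYE j" for y
  proof -
    obtain m' e1 where y: "y = (m', e1)" by (cases y)
    have m': "m' \<in> FY" "mon_deg m' + e1 = j" using that y by (auto simp: FYE_def)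
    have "?b * fy_elem y = Poly_Mapping.single (m' + dual m) 1 * lin i0 ^ (e1 + ?e')"
      by (simp add: fy_elem_def y power_add mult_single[of _ "1::rat" _ 1, simplified, symmetric] mult_ac)
    moreover have "mon_deg (m' + dual m) + (e1 + ?e') + 1 = k"
      using m m' mon_deg_dual[OF m(1)] by (simp add: mon_deg_add)
    ultimately have "degmap (?b * fy_elem y) = degmon (m' + dual m)"
      using degmap_single_lin_power[OF i0_E] by metis
    moreover have "degmap (qscale a p) = a * degmap p" for a p
    proof -
      have "Poly_Mapping.keys (qscale a p) \<subseteq> Poly_Mapping.keys p"
        by (auto simp: qscale_def in_keys_iff Poly_Mapping.map.rep_eq)
      then show ?thesis
        by (subst degmap_superset[of "Poly_Mapping.keys p"])
           (auto simp: degmap_def sum_distrib_left qscale_def Poly_Mapping.map.rep_eq when_def intro!: sum.cong)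
    qed
    moreover have "?b * qscale (c y) (fy_elem y) = qscale (c y) (?b * fy_elem y)"
      by (simp only: qscale_eq mult.left_commute)
    ultimately show ?thesis using y by simp
  qed
  have "0 = degmap (?b * (\<Sum>x\<in>FYE j. qscale (c x) (fy_elem x)))"
    using degmap_ideal[OF assms] by simp
  also have "\<dots> = (\<Sum>y\<in>FYE j. c y * degmon (fst y + dual m))"
    unfolding sum_distrib_left degmap_sum by (rule sum.cong[OF refl pair])
  also have "\<dots> = (\<Sum>y\<in>{x}. c y * degmon (fst y + dual m))"
  proof (rule sum.mono_neutral_right[OF finite_FYE])
    show "{x} \<subseteq> FYE j" using x(1) by (simp add: S_def)
    show "\<forall>y\<in>FYE j - {x}. c y * degmon (fst y + dual m) = 0"
    proof
      fix y assume y: "y \<in> FYE j - {x}"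
      obtain m' e1 where y': "y = (m', e1)" by (cases y)
      have m': "m' \<in> FY" "mon_deg m' + e1 = j" using y y' by (auto simp: FYE_def)
      \<comment> \<open>In a fixed degree j the exponent of alpha is determined by the
        monomial.\<close>
      have "m' \<noteq> m" using y y' me m' m by auto
      then have "c y = 0 \<or> degmon (m' + dual m) = 0"
        using degmon_dual_triangular[OF m'(1) m(1)] x(2)[of y] y y' me by (auto simp: S_def)
      then show "c y * degmon (fst y + dual m) = 0" using y' by auto
    qed
  qed
  finally show False using degmon_dual_self[OF m(1)] x(1) me by (simp add: S_def)
qed

end

subsection \<open>Spanning\<close>

lemma polys_in_0: "0 \<in> polys_in W"
  by (simp add: polys_in_def)

lemma polys_in_single: "Poly_Mapping.keys m \<subseteq> W \<Longrightarrow> Poly_Mapping.single m c \<in> polys_in W"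
  by (simp add: polys_in_def)

lemma polys_in_1: "1 \<in> polys_in W"
  by (simp add: polys_in_def)

lemma polys_in_mvar: "v \<in> W \<Longrightarrow> mvar v \<in> polys_in W"
  unfolding mvar_def by (rule polys_in_single) simp

lemma polys_in_add: "p \<in> polys_in W \<Longrightarrow> q \<in> polys_in W \<Longrightarrow> p + q \<in> polys_in W"
  unfolding polys_in_def using Poly_Mapping.keys_add[of p q] by blast

lemma polys_in_uminus: "p \<in> polys_in W \<Longrightarrow> - p \<in> polys_in W"
  by (simp add: polys_in_def in_keys_iff)

lemma polys_in_diff: "p \<in> polys_in W \<Longrightarrow> q \<in> polys_in W \<Longrightarrow> p - q \<in> polys_in W"
  using polys_in_add[of p W "- q"] polys_in_uminus by auto

lemma polys_in_mult: "p \<in> polys_in W \<Longrightarrow> q \<in> polys_in W \<Longrightarrow> p * q \<in> polys_in W"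
  unfolding polys_in_def using keys_mult[of p q] by (fastforce simp: keys_add_nat)

lemma polys_in_sum: "(\<And>x. x \<in> A \<Longrightarrow> f x \<in> polys_in W) \<Longrightarrow> sum f A \<in> polys_in W"
  by (induction A rule: infinite_finite_induct) (auto simp: polys_in_0 polys_in_add)

lemma polys_in_power: "p \<in> polys_in W \<Longrightarrow> p ^ e \<in> polys_in W"
  by (induction e) (auto simp: polys_in_1 polys_in_mult)

lemmas polys_in_intros = polys_in_0 polys_in_1 polys_in_mvar polys_in_add polys_in_uminus
  polys_in_diff polys_in_mult polys_in_sum polys_in_power polys_in_single

lemma ideal_in_mult_right: "a \<in> ideal_in W G \<Longrightarrow> s \<in> polys_in W \<Longrightarrow> a * s \<in> ideal_in W G"
  using ideal_in.mult[of a W G s] by (simp add: mult.commute)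

lemma ideal_in_uminus: "a \<in> ideal_in W G \<Longrightarrow> - a \<in> ideal_in W G"
  using ideal_in.mult[of a W G "-1"] by (simp add: polys_in_intros)

lemma ideal_in_diff: "a \<in> ideal_in W G \<Longrightarrow> b \<in> ideal_in W G \<Longrightarrow> a - b \<in> ideal_in W G"
  using ideal_in.add[of a W G "- b"] ideal_in_uminus by auto

lemma ideal_in_sum: "(\<And>x. x \<in> A \<Longrightarrow> f x \<in> ideal_in W G) \<Longrightarrow> sum f A \<in> ideal_in W G"
  by (induction A rule: infinite_finite_induct) (auto intro: ideal_in.intros)

lemma ideal_in_qscale: "a \<in> ideal_in W G \<Longrightarrow> qscale c a \<in> ideal_in W G"
  unfolding qscale_eq by (intro ideal_in.mult polys_in_single) auto

lemma homog_part_0: "0 \<in> homog_part W j"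
  by (simp add: homog_part_def polys_in_0)

lemma homog_part_add: "p \<in> homog_part W j \<Longrightarrow> q \<in> homog_part W j \<Longrightarrow> p + q \<in> homog_part W j"
  unfolding homog_part_def using Poly_Mapping.keys_add[of p q] by (auto simp: polys_in_add)

lemma homog_part_mult: "p \<in> homog_part W i \<Longrightarrow> q \<in> homog_part W j \<Longrightarrow> p * q \<in> homog_part W (i + j)"
  unfolding homog_part_def using keys_mult[of p q] by (fastforce simp: polys_in_mult mon_deg_add)

lemma homog_part_single: "Poly_Mapping.keys m \<subseteq> W \<Longrightarrow> mon_deg m = j \<Longrightarrow> Poly_Mapping.single m c \<in> homog_part W j"
  by (auto simp: homog_part_def polys_in_single)

lemma homog_part_sum: "(\<And>x. x \<in> A \<Longrightarrow> f x \<in> homog_part W j) \<Longrightarrow> sum f A \<in> homog_part W j"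
  by (induction A rule: infinite_finite_induct) (auto simp: homog_part_0 homog_part_add)

lemma homog_part_qscale: "p \<in> homog_part W j \<Longrightarrow> qscale c p \<in> homog_part W j"
  unfolding qscale_eq using homog_part_mult[OF homog_part_single[of 0 W 0 c]] by simp

lemma homog_part_mvar: "v \<in> W \<Longrightarrow> mvar v \<in> homog_part W 1"
  unfolding mvar_def by (rule homog_part_single) auto

lemma homog_part_power: "p \<in> homog_part W j \<Longrightarrow> p ^ e \<in> homog_part W (j * e)"
proof (induction e)
  case 0 then show ?case using homog_part_single[of 0 W 0 1] by simp
next
  case (Suc e) then show ?case using homog_part_mult[of p W j "p ^ e" "j * e"] by simp
qed

lemma single_diff_mult:
  assumes "\<And>v. Poly_Mapping.lookup b v \<le> Poly_Mapping.lookup (m :: 'v \<Rightarrow>\<^sub>0 nat) v"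
  shows "m = (m - b) + b"
  by (rule poly_mapping_eqI) (use assms in \<open>simp add: lookup_add lookup_minus\<close>)

lemma chain_Union_cases:
  assumes "finite C" "is_chain C" shows "\<Union>C = {} \<or> \<Union>C \<in> C"
  using assms
proof (induction C rule: finite_induct)
  case (insert F C)
  then have "\<Union>C = {} \<or> \<Union>C \<in> C" using is_chain_subset[of "insert F C" C] by blast
  moreover have "F \<subseteq> H \<or> H \<subseteq> F" if "H \<in> C" for H
    using insert.prems that by (auto simp: is_chain_def)
  then have "F \<subseteq> \<Union>C \<or> \<Union>C \<subseteq> F" by blast
  then have "\<Union>(insert F C) = \<Union>C \<or> \<Union>(insert F C) = F" by auto
  ultimately show ?case by auto
qed simp

definition weight :: "('a set \<Rightarrow>\<^sub>0 nat) \<Rightarrow> nat" where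
  "weight m = (\<Sum>F\<in>Poly_Mapping.keys m. card F * Poly_Mapping.lookup m F)"

lemma weight_superset:
  "finite S \<Longrightarrow> Poly_Mapping.keys m \<subseteq> S \<Longrightarrow> weight m = (\<Sum>F\<in>S. card F * Poly_Mapping.lookup m F)"
  unfolding weight_def by (rule sum.mono_neutral_left) (auto simp: in_keys_iff)

lemma weight_add: "weight (a + b) = weight a + weight b"
proof -
  let ?S = "Poly_Mapping.keys a \<union> Poly_Mapping.keys b"
  have "weight (a + b) = (\<Sum>v\<in>?S. card v * Poly_Mapping.lookup (a + b) v)"
    "weight a = (\<Sum>v\<in>?S. card v * Poly_Mapping.lookup a v)" "weight b = (\<Sum>v\<in>?S. card v * Poly_Mapping.lookup b v)"
    by (rule weight_superset; simp add: keys_add_nat)+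
  then show ?thesis by (simp add: lookup_add sum.distrib distrib_left)
qed

lemma weight_single [simp]: "weight (Poly_Mapping.single F d) = card F * d"
  by (subst weight_superset[of "{F}"]) auto

section \<open>Relations in the Chow ring\<close>

context uniform_chow
begin

abbreviation I :: "'a set mpoly set" where "I \<equiv> ideal_in V gens"

text \<open>The empty set stands for a missing predecessor and contributes the factor 1.\<close>

definition X :: "'a set \<Rightarrow> 'a set mpoly" where
  "X G = (if G = {} then 1 else mvar G)"

text \<open>As \<open>- lin i0\<close> represents \<open>x\<^sub>E\<close>, this is the sum of \<open>x\<^sub>H\<close> over all flats \<open>H \<supseteq> F\<close>, with \<open>E\<close> included.\<close>

definition Z :: "'a set \<Rightarrow> 'a set mpoly" where
  "Z F = (\<Sum>H\<in>{H\<in>V. F \<subseteq> H}. mvar H) - lin i0"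

lemma lin_polys_in: "lin i \<in> polys_in V"
  unfolding lin_def by (intro polys_in_intros) auto

lemma X_polys_in: "G = {} \<or> G \<in> V \<Longrightarrow> X G \<in> polys_in V"
  by (auto simp: X_def intro: polys_in_intros)

lemma Z_polys_in: "Z F \<in> polys_in V"
  unfolding Z_def by (intro polys_in_intros lin_polys_in) auto

lemma lin_diff_I: "i \<in> E \<Longrightarrow> j \<in> E \<Longrightarrow> lin i - lin j \<in> I"
  by (rule ideal_in.gen) (auto simp: gens_def)

text \<open>Writing alpha through a, Z F becomes minus the sum of x_H over the H that contain a but
  not F. Each such H is incomparable with K: it contains a, and K inside H would give F inside
  insert a K, hence inside H.\<close>

lemma mvar_mult_Z:
  assumes "K \<in> V" "a \<in> E" "a \<notin> K" "F \<subseteq> insert a K" "a \<in> F"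
  shows "mvar K * Z F \<in> I"
proof -
  have "lin a = (\<Sum>H\<in>{H\<in>V. F \<subseteq> H}. mvar H) + (\<Sum>H\<in>{H\<in>V. a \<in> H \<and> \<not> F \<subseteq> H}. mvar H)"
  proof -
    have "{H\<in>V. a \<in> H} = {H\<in>V. F \<subseteq> H} \<union> {H\<in>V. a \<in> H \<and> \<not> F \<subseteq> H}" using assms(5) by auto
    then show ?thesis unfolding lin_def
      using finite_V by (subst sum.union_disjoint[symmetric]) auto
  qed
  then have "Z F = (lin a - lin i0) - (\<Sum>H\<in>{H\<in>V. a \<in> H \<and> \<not> F \<subseteq> H}. mvar H)"
    by (simp add: Z_def)
  then have "mvar K * Z F = mvar K * (lin a - lin i0) - (\<Sum>H\<in>{H\<in>V. a \<in> H \<and> \<not> F \<subseteq> H}. mvar K * mvar H)"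
    by (simp add: right_diff_distrib sum_distrib_left)
  also have "\<dots> \<in> I"
  proof (rule ideal_in_diff)
    show "mvar K * (lin a - lin i0) \<in> I"
      by (intro ideal_in.mult lin_diff_I polys_in_mvar assms i0_E)
    show "(\<Sum>H\<in>{H\<in>V. a \<in> H \<and> \<not> F \<subseteq> H}. mvar K * mvar H) \<in> I"
    proof (rule ideal_in_sum)
      fix H assume "H \<in> {H\<in>V. a \<in> H \<and> \<not> F \<subseteq> H}"
      then have H: "H \<in> V" "\<not> K \<subseteq> H" "\<not> H \<subseteq> K" using assms by auto
      then show "mvar K * mvar H \<in> I"
        by (intro ideal_in.gen) (use assms(1) in \<open>auto simp: gens_def\<close>)
    qed
  qed
  finally show ?thesis .
qed

text \<open>The difference of the two sums consists of x_K with a outside K and F inside insert a K,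
  and \<open>mvar_mult_Z\<close> kills each of these. So in a product with Z F, every further factor
  Z F may lose the element a.\<close>

lemma Z_square:
  assumes "a \<in> E" "a \<in> F"
  shows "Z F * (Z F - Z (F - {a})) \<in> I"
proof -
  let ?S = "{K\<in>V. F - {a} \<subseteq> K \<and> a \<notin> K}"
  have "{K\<in>V. F - {a} \<subseteq> K} = {K\<in>V. F \<subseteq> K} \<union> ?S" using assms by auto
  then have "(\<Sum>K\<in>{K\<in>V. F - {a} \<subseteq> K}. mvar K) = (\<Sum>K\<in>{K\<in>V. F \<subseteq> K}. mvar K) + (\<Sum>K\<in>?S. mvar K :: 'a set mpoly)"
    using finite_V assms by (subst sum.union_disjoint[symmetric]) auto
  then have "Z F - Z (F - {a}) = - (\<Sum>K\<in>?S. mvar K)"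
    by (simp add: Z_def)
  then have "Z F * (Z F - Z (F - {a})) = - (\<Sum>K\<in>?S. mvar K * Z F)"
    by (simp add: sum_distrib_left mult.commute)
  also have "\<dots> \<in> I"
    by (intro ideal_in_uminus ideal_in_sum, rule mvar_mult_Z[of _ a]) (use assms in auto)
  finally show ?thesis .
qed

lemma Z_power:
  assumes "a \<in> E" "a \<in> F"
  shows "Z F ^ Suc t - Z F * Z (F - {a}) ^ t \<in> I"
proof (induction t)
  case 0 show ?case by (simp add: ideal_in.zero)
next
  case (Suc t)
  have "Z F ^ Suc (Suc t) - Z F * Z (F - {a}) ^ Suc t =
    Z F * (Z F ^ Suc t - Z F * Z (F - {a}) ^ t) + Z (F - {a}) ^ t * (Z F * (Z F - Z (F - {a})))"
    by (simp add: algebra_simps)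
  also have "\<dots> \<in> I"
    by (intro ideal_in.add ideal_in.mult Suc.IH Z_square assms polys_in_intros Z_polys_in)
  finally show ?case .
qed

text \<open>Induction on the gap: \<open>Z_power\<close> keeps one factor Z F and turns the others
  into Z (F - {a}), to which the hypothesis applies. For gap 1 it is \<open>mvar_mult_Z\<close> with
  K = G, or a linear relation if G is empty.\<close>

lemma X_mult_Z_power:
  assumes "G \<subset> F" "F \<subseteq> E" "G = {} \<or> G \<in> V"
  shows "X G * Z F ^ (card F - card G) \<in> I"
proof -
  have "X G * Z F ^ Suc t \<in> I" if "card F - card G = Suc t" "G \<subset> F" "F \<subseteq> E" for F t
    using that
  proof (induction t arbitrary: F)
    case 0
    have fin: "finite F" using 0 finE finite_subset by blast
    obtain a where a: "a \<in> F" "a \<notin> G" using 0 by auto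
    have "finite G" "G \<subseteq> F" using 0 fin finite_subset by auto
    then have "card (F - G) = 1" using 0 by (simp add: card_Diff_subset)
    then obtain x where "F - G = {x}" by (rule card_1_singletonE)
    moreover have "a \<in> F - G" using a by simp
    ultimately have "F - G = {a}" by simp
    then have F: "F = insert a G" using 0 by auto
    have aE: "a \<in> E" using a 0 by auto
    show ?case
    proof (cases "G = {}")
      case True
      then have "Z F = lin a - lin i0" using F by (simp add: Z_def lin_def)
      then show ?thesis using lin_diff_I[OF aE i0_E] True by (simp add: X_def)
    next
      case False
      then show ?thesis using mvar_mult_Z[of G a F] a aE F assms(3) by (simp add: X_def)
    qed
  next
    case (Suc t)
    have fin: "finite F" using Suc finE finite_subset by blast
    obtain a where a: "a \<in> F" "a \<notin> G" using Suc by auto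
    have aE: "a \<in> E" using a Suc by auto
    let ?F = "F - {a}"
    have c: "card ?F - card G = Suc t" using Suc.prems a fin by simp
    then have "G \<noteq> ?F" by auto
    then have IH: "X G * Z ?F ^ Suc t \<in> I" using Suc.IH[of ?F] c Suc.prems a by blast
    have "X G * Z F ^ Suc (Suc t) =
      X G * (Z F ^ Suc (Suc t) - Z F * Z ?F ^ Suc t) + Z F * (X G * Z ?F ^ Suc t)"
      by (simp add: algebra_simps)
    also have "\<dots> \<in> I"
      by (intro ideal_in.add ideal_in.mult IH Z_power aE a Z_polys_in X_polys_in assms)
    finally show ?case .
  qed
  moreover have "card G < card F"
    by (rule psubset_card_mono[OF finite_subset[OF assms(2) finE] assms(1)])
  ultimately show ?thesis using assms by (metis Suc_pred zero_less_diff)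
qed

text \<open>Take any k-set F containing G. No proper flat contains it, so Z F is just -
  \<open>lin i0\<close> and \<open>X_mult_Z_power\<close> applies. This is the bound on the exponent
  of alpha in \<open>FYE\<close>.\<close>

lemma X_mult_lin_power:
  assumes "G = {} \<or> G \<in> V"
  shows "X G * lin i0 ^ (k - card G) \<in> I"
proof -
  have G: "G \<subseteq> E" "card G < k" using assms k1 by (auto simp: V_def)
  obtain F where F: "G \<subseteq> F" "F \<subseteq> E" "card F = k"
  proof -
    have "k - card G \<le> card (E - G)" using G kE finE by (simp add: card_Diff_subset finite_subset)
    then obtain H where H: "H \<subseteq> E - G" "card H = k - card G" "finite H" using obtain_subset_with_card_n by metis
    have "card (G \<union> H) = k" using H G finE by (subst card_Un_disjoint) (auto intro: finite_subset)
    then show ?thesis using that[of "G \<union> H"] H G by auto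
  qed
  have "\<not> F \<subseteq> H" if "H \<in> V" for H
  proof
    assume "F \<subseteq> H"
    then have "card F \<le> card H" by (rule card_mono[OF V_finite[OF that]])
    then show False using that F(3) by (simp add: V_def)
  qed
  then have "{H\<in>V. F \<subseteq> H} = {}" by blast
  then have "Z F = - lin i0" unfolding Z_def by (simp only: sum.empty diff_0)
  moreover have "G \<subset> F" using F G by auto
  then have "X G * Z F ^ (card F - card G) \<in> I" by (rule X_mult_Z_power) (use F assms in auto)
  ultimately have "X G * (- lin i0) ^ (k - card G) \<in> I" using F(3) by simp
  moreover have "X G * (- lin i0) ^ (k - card G) = (-1) ^ (k - card G) * (X G * lin i0 ^ (k - card G))"
    by (subst power_minus) (simp add: mult_ac)
  ultimately have "(-1) ^ (k - card G) * ((-1) ^ (k - card G) * (X G * lin i0 ^ (k - card G))) \<in> I"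
    by (metis ideal_in.mult polys_in_power polys_in_uminus polys_in_1)
  then show ?thesis by (simp add: mult.assoc[symmetric] power_mult_distrib[symmetric])
qed

text \<open>Filtration by weight, where \<open>x\<^sub>F\<close> has weight \<open>card F\<close> and \<open>x\<^sub>E\<close> has weight \<open>k\<close>. In each degree the weight
  is bounded, so a rewriting that increases it terminates.\<close>

inductive_set filt :: "nat \<Rightarrow> nat \<Rightarrow> 'a set mpoly set" for j w :: nat where
  mono: "Poly_Mapping.keys m \<subseteq> V \<Longrightarrow> mon_deg m + e = j \<Longrightarrow> w \<le> weight m + k * e
    \<Longrightarrow> Poly_Mapping.single m c * lin i0 ^ e \<in> filt j w"
| zero: "0 \<in> filt j w"
| add: "p \<in> filt j w \<Longrightarrow> q \<in> filt j w \<Longrightarrow> p + q \<in> filt j w"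

lemma filt_antimono: "p \<in> filt j w \<Longrightarrow> w' \<le> w \<Longrightarrow> p \<in> filt j w'"
  by (induction rule: filt.induct) (auto intro: filt.intros)

lemma filt_mult:
  assumes "p \<in> filt j w" "q \<in> filt j' w'"
  shows "p * q \<in> filt (j + j') (w + w')"
  using assms(1)
proof (induction rule: filt.induct)
  case (mono m e c)
  from assms(2) show ?case
  proof (induction rule: filt.induct)
    case (mono m' e' c')
    have "Poly_Mapping.single m c * lin i0 ^ e * (Poly_Mapping.single m' c' * lin i0 ^ e') =
      Poly_Mapping.single (m + m') (c * c') * lin i0 ^ (e + e')"
    proof -
      have "Poly_Mapping.single (m + m') (c * c') = Poly_Mapping.single m c * Poly_Mapping.single m' c'"
        by (simp add: mult_single)
      then show ?thesis by (simp only: power_add mult_ac)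
    qed
    also have "\<dots> \<in> filt (j + j') (w + w')"
      by (rule filt.mono) (use mono \<open>Poly_Mapping.keys m \<subseteq> V\<close> \<open>mon_deg m + e = j\<close> \<open>w \<le> weight m + k * e\<close>
         in \<open>auto simp: keys_add_nat mon_deg_add weight_add algebra_simps\<close>)
    finally show ?case .
  qed (auto simp: distrib_left intro: filt.intros)
qed (auto simp: distrib_right intro: filt.intros)

lemma filt_sum: "(\<And>x. x \<in> A \<Longrightarrow> f x \<in> filt j w) \<Longrightarrow> sum f A \<in> filt j w"
  by (induction A rule: infinite_finite_induct) (auto intro: filt.intros)

lemma filt_uminus: "p \<in> filt j w \<Longrightarrow> - p \<in> filt j w"
proof (induction rule: filt.induct)
  case (mono m e c)
  then show ?case using filt.mono[of m e j w "- c"] by (simp add: single_uminus)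
next
  case (add p q)
  then show ?case using filt.add[of "- p" j w "- q"] by simp
qed (auto intro: filt.intros)

lemma filt_single: "Poly_Mapping.keys m \<subseteq> V \<Longrightarrow> Poly_Mapping.single m c \<in> filt (mon_deg m) (weight m)"
  using filt.mono[of m 0 "mon_deg m" "weight m" c] by simp

lemma filt_mvar: "F \<in> V \<Longrightarrow> mvar F \<in> filt 1 (card F)"
  unfolding mvar_def using filt_single[of "Poly_Mapping.single F 1" 1] by simp

lemma filt_lin: "lin i0 ^ e \<in> filt e (k * e)"
  using filt.mono[of 0 e e "k * e" 1] by simp

lemma filt_power: "p \<in> filt j w \<Longrightarrow> p ^ e \<in> filt (j * e) (w * e)"
proof (induction e)
  case 0 show ?case using filt_lin[of 0] by simp
next
  case (Suc e) then show ?case using filt_mult[of p j w "p ^ e" "j * e" "w * e"] by simp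
qed

lemma filt_power_diff:
  assumes "x \<in> filt 1 a" "u \<in> filt 1 (Suc a)"
  shows "(x + u) ^ g - x ^ g \<in> filt g (Suc (a * g))"
proof (induction g)
  case 0 show ?case by (simp add: filt.zero)
next
  case (Suc g)
  have "(x + u) ^ Suc g - x ^ Suc g = (x + u) * ((x + u) ^ g - x ^ g) + u * x ^ g"
    by (simp add: algebra_simps)
  moreover have "x + u \<in> filt 1 a" using assms filt_antimono[OF assms(2)] by (auto intro: filt.add)
  then have "(x + u) * ((x + u) ^ g - x ^ g) \<in> filt (1 + g) (a + Suc (a * g))"
    using Suc filt_mult by blast
  moreover have "u * x ^ g \<in> filt (1 + g) (Suc a + a * g)"
    using filt_mult[OF assms(2) filt_power[OF assms(1), of g]] by simp
  ultimately show ?case by (simp add: filt.add)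
qed

text \<open>The other terms of Z F are x_H with H larger than F, and x_E of weight k. So x_F leads Z
  F, and x_G Z_F^g = 0 rewrites x_G x_F^g by heavier terms.\<close>

lemma Z_minus_mvar_filt:
  assumes "F \<in> V"
  shows "Z F - mvar F \<in> filt 1 (Suc (card F))"
proof -
  have "{H\<in>V. F \<subseteq> H} = insert F {H\<in>V. F \<subset> H}" using assms by auto
  then have "Z F - mvar F = (\<Sum>H\<in>{H\<in>V. F \<subset> H}. mvar H) + - (lin i0 ^ 1)"
    unfolding Z_def using finite_V by simp
  also have "\<dots> \<in> filt 1 (Suc (card F))"
  proof (intro filt.add filt_sum filt_uminus)
    show "lin i0 ^ 1 \<in> filt 1 (Suc (card F))"
      by (rule filt_antimono[OF filt_lin]) (use assms in \<open>simp add: V_def\<close>)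
    fix H assume H: "H \<in> {H\<in>V. F \<subset> H}"
    then have "card F < card H" by (auto intro: psubset_card_mono V_finite)
    then show "mvar H \<in> filt 1 (Suc (card F))"
      using H by (intro filt_antimono[OF filt_mvar]) auto
  qed
  finally show ?thesis .
qed

section \<open>Reduction to the monomial basis\<close>

definition reducible :: "nat \<Rightarrow> 'a set mpoly \<Rightarrow> bool" where
  "reducible j p \<longleftrightarrow> (\<exists>c. p - (\<Sum>x\<in>FYE j. qscale (c x) (fy_elem x)) \<in> I)"

lemma reducible_I: "p \<in> I \<Longrightarrow> reducible j p"
  unfolding reducible_def by (intro exI[of _ "\<lambda>_. 0"]) (simp add: qscale_eq)

lemma reducible_add:
  assumes "reducible j p" "reducible j q"
  shows "reducible j (p + q)"
proof -
  obtain c d where "p - (\<Sum>x\<in>FYE j. qscale (c x) (fy_elem x)) \<in> I" "q - (\<Sum>x\<in>FYE j. qscale (d x) (fy_elem x)) \<in> I"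
    using assms unfolding reducible_def by blast
  then have "(p - (\<Sum>x\<in>FYE j. qscale (c x) (fy_elem x))) + (q - (\<Sum>x\<in>FYE j. qscale (d x) (fy_elem x))) \<in> I"
    by (rule ideal_in.add)
  also have "(p - (\<Sum>x\<in>FYE j. qscale (c x) (fy_elem x))) + (q - (\<Sum>x\<in>FYE j. qscale (d x) (fy_elem x)))
    = (p + q) - (\<Sum>x\<in>FYE j. qscale (c x + d x) (fy_elem x))"
    by (simp add: qscale_eq single_add distrib_right sum.distrib)
  finally show ?thesis unfolding reducible_def by (intro exI[of _ "\<lambda>x. c x + d x"])
qed

lemma reducible_fy_elem:
  assumes "x \<in> FYE j" shows "reducible j (qscale a (fy_elem x))"
proof -
  have "(\<Sum>y\<in>FYE j. qscale (if y = x then a else 0) (fy_elem y)) = (\<Sum>y\<in>FYE j. if y = x then qscale a (fy_elem x) else 0)"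
    by (rule sum.cong) (auto simp: qscale_eq)
  also have "\<dots> = qscale a (fy_elem x)" using assms finite_FYE by simp
  finally show ?thesis unfolding reducible_def
    by (intro exI[of _ "\<lambda>y. if y = x then a else 0"]) (simp add: ideal_in.zero)
qed

text \<open>A monomial off chains is in the ideal, and so is one with too high a power of alpha. An
  exponent too large at some F is pushed to greater weight. Otherwise it is a basis element up to a
  scalar.\<close>

lemma reducible_step:
  assumes m: "Poly_Mapping.keys m \<subseteq> V" "mon_deg m + e = j"
    and IH: "\<And>p. p \<in> filt j (Suc (weight m + k * e)) \<Longrightarrow> reducible j p"
  shows "reducible j (Poly_Mapping.single m c * lin i0 ^ e)"
proof -
  let ?k = "Poly_Mapping.keys m"
  let ?p = "Poly_Mapping.single m c * lin i0 ^ e"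
  have linp: "lin i0 ^ t \<in> polys_in V" for t by (intro polys_in_intros lin_polys_in)
  have split: "Poly_Mapping.single m c = Poly_Mapping.single (m - b) c * Poly_Mapping.single b 1"
    if "\<And>v. Poly_Mapping.lookup b v \<le> Poly_Mapping.lookup m v" for b
    using single_diff_mult[OF that] by (simp add: mult_single)
  have keysd: "Poly_Mapping.keys (m - b) \<subseteq> V" for b
    using m(1) by (auto simp: in_keys_iff lookup_minus)
  have Xsingle: "X G = Poly_Mapping.single (if G = {} then 0 else Poly_Mapping.single G 1) 1" for G
    by (simp add: X_def mvar_def)
  consider "\<not> is_chain ?k" | F where "is_chain ?k" "F \<in> ?k" "card F \<le> Poly_Mapping.lookup m F + card (low m F)"
    | "m \<in> FY" "k \<le> e + card (\<Union>?k)" | "(m, e) \<in> FYE j"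
  proof -
    assume 1: "\<not> is_chain ?k \<Longrightarrow> thesis"
      and 2: "\<And>F. is_chain ?k \<Longrightarrow> F \<in> ?k \<Longrightarrow> card F \<le> Poly_Mapping.lookup m F + card (low m F) \<Longrightarrow> thesis"
      and 3: "m \<in> FY \<Longrightarrow> k \<le> e + card (\<Union>?k) \<Longrightarrow> thesis" and 4: "(m, e) \<in> FYE j \<Longrightarrow> thesis"
    show thesis
    proof (cases "is_chain ?k")
      case True
      show thesis
      proof (cases "m \<in> FY")
        case FY: True
        show thesis
          using 3[OF FY] 4 FY m(2) unfolding FYE_def by (cases "k \<le> e + card (\<Union>?k)") auto
      next
        case False
        then show thesis using True m(1) 2 unfolding FY_def by (auto simp: not_less)
      qed
    qed (rule 1)
  qed
  then show ?thesis
  proof cases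
    case 1
    then obtain F G where FG: "F \<in> ?k" "G \<in> ?k" "\<not> F \<subseteq> G" "\<not> G \<subseteq> F" by (auto simp: is_chain_def)
    let ?b = "Poly_Mapping.single F 1 + Poly_Mapping.single G (1::nat)"
    have "F \<noteq> G" using FG by auto
    then have "Poly_Mapping.single m c = Poly_Mapping.single (m - ?b) c * Poly_Mapping.single ?b 1"
      using FG by (intro split) (auto simp: lookup_add lookup_single when_def in_keys_iff Suc_le_eq)
    also have "Poly_Mapping.single ?b 1 = mvar F * mvar G" by (simp add: mvar_def mult_single)
    finally have "?p = Poly_Mapping.single (m - ?b) c * (mvar F * mvar G) * lin i0 ^ e" by simp
    also have "\<dots> \<in> I"
      by (intro ideal_in_mult_right ideal_in.mult ideal_in.gen linp polys_in_single keysd)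
         (use FG m(1) in \<open>auto simp: gens_def\<close>)
    finally show ?thesis by (rule reducible_I)
  next
    case 2
    define G where "G = low m F"
    \<comment> \<open>The exponent in \<open>X_mult_Z_power\<close>; by the case assumption the
      monomial of \<open>X G\<close> times x_F^g, called \<open>b\<close> below, divides
      x^m.\<close>
    define g where "g = card F - card G"
    have FV: "F \<in> V" using 2 m by auto
    have "is_chain {G \<in> ?k. G \<subset> F}" by (rule is_chain_subset[OF 2(1)]) auto
    then have "G = {} \<or> G \<in> {G \<in> ?k. G \<subset> F}"
      unfolding G_def low_def by (intro chain_Union_cases) auto
    then have G: "G = {} \<or> G \<in> V" "G \<subset> F" "G \<noteq> {} \<Longrightarrow> G \<in> ?k"
      using m(1) FV by (auto simp: V_def)
    have cGF: "card G < card F" using G(2) V_finite[OF FV] psubset_card_mono by blast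
    have g: "g \<le> Poly_Mapping.lookup m F" using 2(3) by (simp add: g_def G_def)
    define xG where "xG = (if G = {} then 0 else Poly_Mapping.single G (1::nat))"
    define b where "b = xG + Poly_Mapping.single F g"
    let ?q = "Poly_Mapping.single (m - b) c * X G * lin i0 ^ e"
    have "G \<noteq> F" using G(2) by blast
    moreover have "G \<noteq> {} \<Longrightarrow> 1 \<le> Poly_Mapping.lookup m G"
      using G(3) by (simp add: in_keys_iff Suc_le_eq)
    ultimately have le: "Poly_Mapping.lookup b v \<le> Poly_Mapping.lookup m v" for v
      using g unfolding b_def xG_def by (auto simp: lookup_add lookup_single when_def)
    have mvp: "Poly_Mapping.single (Poly_Mapping.single F t) 1 = mvar F ^ t" for t
    proof (induction t)
      case (Suc t)
      have "Poly_Mapping.single F (Suc t) = Poly_Mapping.single F 1 + Poly_Mapping.single F t"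
        by (simp add: single_add[symmetric])
      moreover have "mvar F ^ Suc t = mvar F * Poly_Mapping.single (Poly_Mapping.single F t) 1"
        unfolding power_Suc Suc.IH ..
      ultimately show ?case by (simp add: mvar_def mult_single)
    qed simp
    have XG: "X G = Poly_Mapping.single xG 1" unfolding Xsingle xG_def ..
    have bX: "Poly_Mapping.single b 1 = X G * mvar F ^ g"
      unfolding XG mvp[symmetric] b_def by (simp add: mult_single)
    have "?p = Poly_Mapping.single (m - b) c * Poly_Mapping.single b 1 * lin i0 ^ e"
      by (rule arg_cong[OF split[OF le]])
    also have "\<dots> = ?q * mvar F ^ g"
      unfolding bX by (simp only: mult_ac)
    \<comment> \<open>Modulo the ideal, x_F^g is replaced by x_F^g - Z_F^g, which lies in the next
      filtration step.\<close>
    also have "?q * mvar F ^ g = ?q * Z F ^ g + - (?q * ((mvar F + (Z F - mvar F)) ^ g - mvar F ^ g))"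
      by (simp add: algebra_simps)
    finally have p: "?p = \<dots>" .
    have "X G * Z F ^ g \<in> I" unfolding g_def
      by (rule X_mult_Z_power) (use G FV in \<open>auto simp: V_def\<close>)
    then have "(Poly_Mapping.single (m - b) c * lin i0 ^ e) * (X G * Z F ^ g) \<in> I"
      by (rule ideal_in.mult) (intro polys_in_mult linp polys_in_single keysd)
    then have 1: "?q * Z F ^ g \<in> I" by (simp only: mult_ac)
    have keysG: "Poly_Mapping.keys (m - b + xG) \<subseteq> V"
      using keysd[of b] G(1) unfolding keys_add_nat xG_def by auto
    have mb: "m = (m - b + xG) + Poly_Mapping.single F g"
    proof -
      have "m = (m - b) + b" by (rule single_diff_mult[OF le])
      also have "(m - b) + b = (m - b + xG) + Poly_Mapping.single F g"
        by (subst (2) b_def) (simp only: add.assoc)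
      finally show ?thesis .
    qed
    have "?q = Poly_Mapping.single (m - b + xG) c * lin i0 ^ e"
      unfolding XG by (simp add: mult_single)
    also have "\<dots> \<in> filt (mon_deg (m - b + xG) + e) (weight (m - b + xG) + k * e)"
      by (rule filt.mono[OF keysG]) auto
    finally have "?q * ((mvar F + (Z F - mvar F)) ^ g - mvar F ^ g) \<in>
      filt (mon_deg (m - b + xG) + e + g) (weight (m - b + xG) + k * e + Suc (card F * g))"
      by (rule filt_mult) (intro filt_power_diff filt_mvar Z_minus_mvar_filt FV)
    moreover have "mon_deg (m - b + xG) + g = mon_deg m"
      using arg_cong[OF mb, of mon_deg] by (simp only: mon_deg_add mon_deg_single)
    moreover have "weight (m - b + xG) + card F * g = weight m"
      using arg_cong[OF mb, of weight] by (simp only: weight_add weight_single)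
    moreover have "a + e + g = j \<and> w + k * e + Suc (card F * g) = Suc (weight m + k * e)"
      if "a + g = mon_deg m" "w + card F * g = weight m" for a w
      using that m(2) by simp
    ultimately have "?q * ((mvar F + (Z F - mvar F)) ^ g - mvar F ^ g) \<in> filt j (Suc (weight m + k * e))"
      by metis
    then have "reducible j (- (?q * ((mvar F + (Z F - mvar F)) ^ g - mvar F ^ g)))"
      by (intro IH filt_uminus)
    then show ?thesis unfolding p by (rule reducible_add[OF reducible_I[OF 1]])
  next
    case 3
    let ?G = "\<Union>?k"
    have G: "?G = {} \<or> ?G \<in> ?k" using FY_D(2)[OF 3(1)] by (intro chain_Union_cases) auto
    let ?b = "if ?G = {} then 0 else Poly_Mapping.single ?G (1::nat)"
    have e: "e = (k - card ?G) + (e - (k - card ?G))" using 3 by simp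
    have le: "lin i0 ^ e = lin i0 ^ (k - card ?G) * lin i0 ^ (e - (k - card ?G))"
      using e by (metis power_add)
    have sp: "Poly_Mapping.single m c = Poly_Mapping.single (m - ?b) c * X ?G"
      unfolding Xsingle using G by (intro split) (auto simp: lookup_single when_def in_keys_iff Suc_le_eq)
    have "?p = Poly_Mapping.single (m - ?b) c * lin i0 ^ (e - (k - card ?G)) * (X ?G * lin i0 ^ (k - card ?G))"
      unfolding sp le by (simp only: mult_ac)
    also have "\<dots> \<in> I"
      by (intro ideal_in.mult polys_in_mult linp polys_in_single keysd X_mult_lin_power) (use G m(1) in auto)
    finally show ?thesis by (rule reducible_I)
  next
    case 4
    have "?p = qscale c (fy_elem (m, e))"
      by (simp add: fy_elem_def qscale_eq mult.assoc[symmetric] mult_single)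
    then show ?thesis using reducible_fy_elem[OF 4] by simp
  qed
qed

lemma weight_le: "Poly_Mapping.keys m \<subseteq> V \<Longrightarrow> weight m \<le> k * mon_deg m"
  unfolding weight_def mon_deg_def sum_distrib_left
  by (rule sum_mono, rule mult_right_mono) (auto simp: V_def)

text \<open>Induction on the distance d from w to k j + 1, a weight that no monomial of degree j
  attains.\<close>

lemma filt_reducible: "k * j + 1 \<le> w + d \<Longrightarrow> p \<in> filt j w \<Longrightarrow> reducible j p"
proof (induction d arbitrary: w p)
  case 0
  from 0(2) show ?case
  proof (induction rule: filt.induct)
    case (mono m e c)
    have "weight m + k * e \<le> k * mon_deg m + k * e" using weight_le mono by simp
    also have "\<dots> = k * j" using mono by (simp flip: distrib_left)
    finally show ?case using 0 mono by simp
  qed (auto intro: reducible_add reducible_I ideal_in.zero)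
next
  case (Suc d)
  from Suc.prems(2) show ?case
  proof (induction rule: filt.induct)
    case (mono m e c)
    show ?case
      by (rule reducible_step[OF mono(1,2)], rule Suc.IH) (use Suc.prems mono(3) in auto)
  qed (auto intro: reducible_add reducible_I ideal_in.zero)
qed

lemma homog_reducible:
  assumes "p \<in> homog_part V j" shows "reducible j p"
proof (rule filt_reducible)
  show "p \<in> filt j 0"
  proof (subst mpoly_eq_sum_single[of p], rule filt_sum)
    fix m assume "m \<in> Poly_Mapping.keys p"
    then have "Poly_Mapping.keys m \<subseteq> V" "mon_deg m = j"
      using assms by (auto simp: homog_part_def polys_in_def)
    then show "Poly_Mapping.single m (Poly_Mapping.lookup p m) \<in> filt j 0"
      using filt_antimono[OF filt_single[of m], of 0] by simp
  qed
  show "k * j + 1 \<le> 0 + (k * j + 1)" by simp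
qed

end

subsection \<open>Counting by the top of a chain\<close>

lemma sum_subsets_by_card:
  fixes f :: "nat \<Rightarrow> 'b::comm_semiring_1"
  assumes "finite F"
  shows "(\<Sum>G | G \<subseteq> F \<and> card G < K. f (card G)) = (\<Sum>l<K. of_nat (card F choose l) * f l)"
proof -
  have "(\<Sum>G | G \<subseteq> F \<and> card G < K. f (card G)) =
     (\<Sum>l<K. \<Sum>G\<in>{G \<in> {G. G \<subseteq> F \<and> card G < K}. card G = l}. f (card G))"
    by (rule sum.group[symmetric]) (use assms in auto)
  also have "\<dots> = (\<Sum>l<K. of_nat (card F choose l) * f l)"
  proof (rule sum.cong[OF refl])
    fix l assume "l \<in> {..<K}"
    then have "{G \<in> {G. G \<subseteq> F \<and> card G < K}. card G = l} = {G. G \<subseteq> F \<and> card G = l}" by auto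
    then show "(\<Sum>G\<in>{G \<in> {G. G \<subseteq> F \<and> card G < K}. card G = l}. f (card G)) = of_nat (card F choose l) * f l"
      by (simp add: n_subsets[OF assms])
  qed
  finally show ?thesis .
qed

lemma sum_psubsets_by_card:
  fixes f :: "nat \<Rightarrow> 'b::comm_semiring_1"
  assumes "finite F"
  shows "(\<Sum>G | G \<subset> F. f (card G)) = (\<Sum>l<card F. of_nat (card F choose l) * f l)"
proof -
  have "{G. G \<subset> F} = {G. G \<subseteq> F \<and> card G < card F}"
    using psubset_card_mono[OF assms] by auto
  then show ?thesis using sum_subsets_by_card[OF assms] by simp
qed

lemma chain_Union_mem: "finite C \<Longrightarrow> is_chain C \<Longrightarrow> \<Union>C \<noteq> {} \<Longrightarrow> \<Union>C \<in> C"
  using chain_Union_cases by blast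

lemma is_chain_insert: "is_chain C \<Longrightarrow> (\<And>H. H \<in> C \<Longrightarrow> H \<subseteq> F) \<Longrightarrow> is_chain (insert F C)"
  by (auto simp: is_chain_def)

text \<open>For finite F the union is the largest member of the chain. The empty chain is included,
  with top {}.\<close>

definition chains_with_top :: "'a set \<Rightarrow> 'a set set set" where
  "chains_with_top F = {C. is_chain C \<and> {} \<notin> C \<and> \<Union>C = F}"

lemma chains_with_top_finite: "finite F \<Longrightarrow> finite (chains_with_top F)"
  by (rule finite_subset[of _ "Pow (Pow F)"]) (auto simp: chains_with_top_def)

lemma chains_with_top_memD:
  assumes "finite F" "C \<in> chains_with_top F"
  shows "finite C"
  using assms by (intro finite_subset[of C "Pow F"]) (auto simp: chains_with_top_def)

text \<open>Every member has gap at least 1, and the gaps sum to |F|.\<close>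

lemma card_chain_le:
  assumes "finite F" "C \<in> chains_with_top F"
  shows "card C \<le> card F"
proof -
  have C: "is_chain C" "{} \<notin> C" "\<Union>C = F" using assms by (auto simp: chains_with_top_def)
  have finC: "finite C" using chains_with_top_memD assms .
  have fin: "finite H" if "H \<in> C" for H
  proof (rule finite_subset[OF _ assms(1)])
    show "H \<subseteq> F" using that C(3) by auto
  qed
  have "card C = (\<Sum>H\<in>C. 1)" by simp
  also have "\<dots> \<le> (\<Sum>H\<in>C. card H - card (\<Union>{G\<in>C. G \<subset> H}))"
  proof (rule sum_mono)
    fix H assume H: "H \<in> C"
    let ?D = "{G\<in>C. G \<subset> H}"
    have "finite ?D" "is_chain ?D" using finC C(1) is_chain_subset[of C ?D] by auto
    then have "\<Union>?D = {} \<or> \<Union>?D \<in> ?D" by (rule chain_Union_cases)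
    then have "\<Union>?D \<subset> H"
    proof
      assume e: "\<Union>?D = {}"
      show ?thesis unfolding e using H C(2) by blast
    next
      assume "\<Union>?D \<in> ?D"
      then show ?thesis unfolding mem_Collect_eq by (rule conjunct2)
    qed
    then have "card (\<Union>?D) < card H" by (rule psubset_card_mono[OF fin[OF H]])
    then show "1 \<le> card H - card (\<Union>?D)" by simp
  qed
  also have "\<dots> = card F" using sum_card_chain_gaps[OF finC C(1) fin] C(3) by simp
  finally show ?thesis .
qed

text \<open>Removing F leaves a chain C' with a smaller top G, and |F| - |C| = (|G| - |C'|) + (|F| -
  |G| - 1). By \<open>card_chain_le\<close> no subtraction truncates, so the sum satisfies the
  recursion of \<open>Eul\<close>.\<close>

lemma sum_chains_with_top:
  assumes "finite F"
  shows "(\<Sum>C\<in>chains_with_top F. [:-1, 1:] ^ (card F - card C)) = Eul (card F)"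
  using assms
proof (induction "card F" arbitrary: F rule: less_induct)
  case less
  show ?case
  proof (cases "F = {}")
    case True
    have "chains_with_top F = {{}}" unfolding True chains_with_top_def by (auto simp: is_chain_def)
    then show ?thesis using True by (simp add: Eul.simps)
  next
    case False
    let ?y = "[:-1, 1:] :: rat poly"
    let ?S = "Sigma {G. G \<subset> F} chains_with_top"
    have finG: "finite G" if "G \<subset> F" for G using that less.prems finite_subset by blast
    have finS: "finite {G. G \<subset> F}"
      by (rule finite_subset[of _ "Pow F"]) (use less.prems in auto)
    have "(\<Sum>C\<in>chains_with_top F. ?y ^ (card F - card C)) =
      (\<Sum>(G, C)\<in>?S. ?y ^ (card G - card C) * ?y ^ (card F - card G - 1))"
    proof (rule sum.reindex_bij_witness[where i="\<lambda>(G, C). insert F C" and j="\<lambda>C. (\<Union>(C - {F}), C - {F})"])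
      fix C assume C: "C \<in> chains_with_top F"
      then have ch: "is_chain C" "{} \<notin> C" "\<Union>C = F" by (auto simp: chains_with_top_def)
      have finC: "finite C" using chains_with_top_memD less.prems C by blast
      have F: "F \<in> C" using chain_Union_mem[OF finC ch(1)] ch False by simp
      show "(case (\<Union>(C - {F}), C - {F}) of (G, C) \<Rightarrow> insert F C) = C" using F by auto
      have c': "is_chain (C - {F})" using ch(1) is_chain_subset by blast
      have "\<Union>(C - {F}) \<noteq> F"
        using chain_Union_mem[OF _ c'] finC False by auto
      moreover have "\<Union>(C - {F}) \<subseteq> F" using ch by auto
      ultimately have sub: "\<Union>(C - {F}) \<subset> F" by blast
      moreover have mem: "C - {F} \<in> chains_with_top (\<Union>(C - {F}))"
        using c' ch by (auto simp: chains_with_top_def)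
      ultimately show "(\<Union>(C - {F}), C - {F}) \<in> ?S" by simp
      have "card (C - {F}) \<le> card (\<Union>(C - {F}))" using card_chain_le[OF finG[OF sub] mem] .
      moreover have "card (\<Union>(C - {F})) < card F" using psubset_card_mono[OF less.prems sub] .
      moreover have "card C = Suc (card (C - {F}))" using F finC by (metis card.remove)
      ultimately have "card F - card C = (card (\<Union>(C - {F})) - card (C - {F})) + (card F - card (\<Union>(C - {F})) - 1)"
        by simp
      then show "(case (\<Union>(C - {F}), C - {F}) of (G, C) \<Rightarrow> ?y ^ (card G - card C) * ?y ^ (card F - card G - 1))
        = ?y ^ (card F - card C)"
        by (simp only: prod.case power_add)
    next
      fix x assume x: "x \<in> ?S"
      obtain G C where GC: "x = (G, C)" by (cases x)
      then have G: "G \<subset> F" and ch: "is_chain C" "{} \<notin> C" "\<Union>C = G"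
        using x by (auto simp: chains_with_top_def)
      have FC: "F \<notin> C" using ch G by blast
      then have "insert F C - {F} = C" by simp
      then show "(case (case x of (G, C) \<Rightarrow> insert F C) of C \<Rightarrow> (\<Union>(C - {F}), C - {F})) = x"
        using GC ch by simp
      have "is_chain (insert F C)" using ch G by (intro is_chain_insert) auto
      then show "(case x of (G, C) \<Rightarrow> insert F C) \<in> chains_with_top F"
        using GC ch G False by (auto simp: chains_with_top_def)
    qed
    also have "\<dots> = (\<Sum>G | G \<subset> F. \<Sum>C\<in>chains_with_top G. ?y ^ (card G - card C) * ?y ^ (card F - card G - 1))"
      by (rule sum.Sigma[symmetric]) (use finS finG chains_with_top_finite in auto)
    also have "\<dots> = (\<Sum>G | G \<subset> F. Eul (card G) * ?y ^ (card F - card G - 1))"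
    proof (rule sum.cong[OF refl])
      fix G assume "G \<in> {G. G \<subset> F}"
      then have G: "card G < card F" "finite G" using psubset_card_mono[OF less.prems] finG by auto
      show "(\<Sum>C\<in>chains_with_top G. ?y ^ (card G - card C) * ?y ^ (card F - card G - 1))
         = Eul (card G) * ?y ^ (card F - card G - 1)"
        unfolding sum_distrib_right[symmetric] less.hyps[OF G] ..
    qed
    also have "\<dots> = (\<Sum>l<card F. of_nat (card F choose l) * (Eul l * ?y ^ (card F - l - 1)))"
      by (rule sum_psubsets_by_card[OF less.prems])
    also have "\<dots> = Eul (card F)"
      using False less.prems by (subst (2) Eul.simps) (simp add: mult.assoc)
    finally show ?thesis .
  qed
qed

section \<open>Basis monomials with a given top flat\<close>

definition FY_with_top :: "'a set \<Rightarrow> ('a set \<Rightarrow>\<^sub>0 nat) set" where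
  "FY_with_top F = {m. is_chain (Poly_Mapping.keys m) \<and> \<Union>(Poly_Mapping.keys m) = F \<and>
     (\<forall>H\<in>Poly_Mapping.keys m. Poly_Mapping.lookup m H + card (low m H) < card H)}"

lemma FY_with_top_empty: "FY_with_top {} = {0}"
proof (rule equalityI; rule subsetI)
  fix m :: "'a set \<Rightarrow>\<^sub>0 nat" assume m: "m \<in> FY_with_top {}"
  have "False" if H: "H \<in> Poly_Mapping.keys m" for H
  proof -
    have "H = {}" using m H by (auto simp: FY_with_top_def)
    moreover have "Poly_Mapping.lookup m H + card (low m H) < card H" using m H by (simp add: FY_with_top_def)
    ultimately show False by simp
  qed
  then have "Poly_Mapping.keys m = {}" by blast
  then show "m \<in> {0}" by simp
qed (auto simp: FY_with_top_def is_chain_def)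

lemma FY_with_top_decompose:
  assumes "finite F" "F \<noteq> {}" "m \<in> FY_with_top F"
  shows "low m F \<subset> F" "Poly_Mapping.update F 0 m \<in> FY_with_top (low m F)"
    "Poly_Mapping.lookup m F \<in> {1..<card F - card (low m F)}"
    "Poly_Mapping.update F 0 m + Poly_Mapping.single F (Poly_Mapping.lookup m F) = m"
proof -
  let ?k = "Poly_Mapping.keys m" and ?m = "Poly_Mapping.update F 0 m"
  have ch: "is_chain ?k" "\<Union>?k = F"
    and gap: "\<And>H. H \<in> ?k \<Longrightarrow> Poly_Mapping.lookup m H + card (low m H) < card H"
    using assms(3) by (auto simp: FY_with_top_def)
  have F: "F \<in> ?k" using chain_Union_mem[OF finite_keys ch(1)] ch(2) assms(2) by simp
  have keys: "Poly_Mapping.keys ?m = {H\<in>?k. H \<subset> F}" unfolding keys_update using ch(2) by auto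
  have c': "is_chain {H\<in>?k. H \<subset> F}" using ch(1) by (rule is_chain_subset) auto
  have "low m F = {} \<or> low m F \<in> {H\<in>?k. H \<subset> F}"
    unfolding low_def using chain_Union_mem[OF _ c'] by auto
  then show "low m F \<subset> F" using assms(2) by auto
  have "low ?m H = low m H" if "H \<subset> F" for H
    unfolding low_def keys using that by (intro arg_cong[of _ _ Union]) auto
  then show "?m \<in> FY_with_top (low m F)"
    using c' gap unfolding FY_with_top_def mem_Collect_eq keys
    by (auto simp: low_def[of m F] lookup_update)
  show "Poly_Mapping.lookup m F \<in> {1..<card F - card (low m F)}"
    using gap[OF F] F by (auto simp: in_keys_iff)
  show "?m + Poly_Mapping.single F (Poly_Mapping.lookup m F) = m"
    by (rule poly_mapping_eqI) (auto simp: lookup_add lookup_single when_def lookup_update)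
qed

lemma FY_with_top_extend:
  assumes "finite F" "G \<subset> F" "m \<in> FY_with_top G" "d \<in> {1..<card F - card G}"
  shows "m + Poly_Mapping.single F d \<in> FY_with_top F"
    "low (m + Poly_Mapping.single F d) F = G"
    "Poly_Mapping.update F 0 (m + Poly_Mapping.single F d) = m"
    "Poly_Mapping.lookup (m + Poly_Mapping.single F d) F = d"
proof -
  let ?k = "Poly_Mapping.keys m" and ?x = "m + Poly_Mapping.single F d"
  have ch: "is_chain ?k" "\<Union>?k = G"
    and gap: "\<And>H. H \<in> ?k \<Longrightarrow> Poly_Mapping.lookup m H + card (low m H) < card H"
    using assms(3) by (auto simp: FY_with_top_def)
  have sub: "H \<subset> F" if "H \<in> ?k" for H using that ch(2) assms(2) by blast
  have nF: "F \<notin> ?k" using sub by blast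
  have keys: "Poly_Mapping.keys ?x = insert F ?k" using assms(4) by (auto simp: keys_add_nat)
  have "{H \<in> insert F ?k. H \<subset> F} = ?k" using sub by blast
  then show lowF: "low ?x F = G" unfolding low_def keys using ch(2) by simp
  have low: "low ?x H = low m H" if "H \<in> ?k" for H
  proof -
    have "{K \<in> insert F ?k. K \<subset> H} = {K \<in> ?k. K \<subset> H}" using sub[OF that] by blast
    then show ?thesis unfolding low_def keys by simp
  qed
  have lk: "Poly_Mapping.lookup ?x H = Poly_Mapping.lookup m H" if "H \<in> ?k" for H
    using that nF by (auto simp: lookup_add lookup_single when_def)
  show d: "Poly_Mapping.lookup ?x F = d" using nF by (simp add: lookup_add in_keys_iff)
  have "is_chain (insert F ?k)" using ch(1) sub by (intro is_chain_insert) auto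
  moreover have "\<Union>(insert F ?k) = F" using sub by blast
  moreover have "Poly_Mapping.lookup ?x H + card (low ?x H) < card H" if "H \<in> insert F ?k" for H
    using that gap low lk d lowF assms(4) by (cases "H = F") auto
  ultimately show "?x \<in> FY_with_top F" unfolding FY_with_top_def keys mem_Collect_eq keys by blast
  show "Poly_Mapping.update F 0 ?x = m"
    using nF by (intro poly_mapping_eqI) (auto simp: lookup_add lookup_single when_def lookup_update in_keys_iff)
qed

text \<open>A monomial with top F corresponds to its predecessor G, the monomial left on G and the
  exponent d of F, as in the recursion of \<open>Der\<close>. Finiteness is carried along, since a
  sum over an infinite set would be 0 by default.\<close>

lemma sum_FY_with_top:
  assumes "finite F"
  shows "finite (FY_with_top F) \<and> (\<Sum>m\<in>FY_with_top F. monom 1 (mon_deg m)) = Der (card F)"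
  using assms
proof (induction "card F" arbitrary: F rule: less_induct)
  case less
  show ?case
  proof (cases "F = {}")
    case True
    then show ?thesis by (simp add: FY_with_top_empty Der.simps)
  next
    case False
    let ?T = "\<lambda>G. FY_with_top G \<times> {1..<card F - card G}"
    let ?S = "Sigma {G. G \<subset> F} ?T"
    let ?i = "\<lambda>(G :: 'a set, m, d). m + Poly_Mapping.single F d"
    have G: "card G < card F" "finite G" if "G \<subset> F" for G
      using that psubset_card_mono[OF less.prems] finite_subset less.prems by auto
    have IH: "finite (FY_with_top G)" "(\<Sum>m\<in>FY_with_top G. monom 1 (mon_deg m)) = Der (card G)"
      if "G \<subset> F" for G
      using less.hyps[OF G[OF that]] by auto
    have finS: "finite {G. G \<subset> F}"
      by (rule finite_subset[of _ "Pow F"]) (use less.prems in auto)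
    have "FY_with_top F \<subseteq> ?i ` ?S"
    proof
      fix m assume m: "m \<in> FY_with_top F"
      note D = FY_with_top_decompose[OF less.prems False m]
      show "m \<in> ?i ` ?S"
        by (rule image_eqI[of _ _ "(low m F, Poly_Mapping.update F 0 m, Poly_Mapping.lookup m F)"])
           (use D in auto)
    qed
    moreover have "finite ?S" by (intro finite_SigmaI finS finite_cartesian_product IH) auto
    ultimately have fin: "finite (FY_with_top F)" using finite_surj by blast
    have "(\<Sum>m\<in>FY_with_top F. monom (1::rat) (mon_deg m)) = (\<Sum>(G, m, d)\<in>?S. monom 1 (mon_deg m) * monom 1 d)"
    proof (rule sum.reindex_bij_witness[where i="?i"
          and j="\<lambda>m. (low m F, Poly_Mapping.update F 0 m, Poly_Mapping.lookup m F)"])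
      fix m assume m: "m \<in> FY_with_top F"
      note D = FY_with_top_decompose[OF less.prems False m]
      show "?i (low m F, Poly_Mapping.update F 0 m, Poly_Mapping.lookup m F) = m" using D(4) by simp
      show "(low m F, Poly_Mapping.update F 0 m, Poly_Mapping.lookup m F) \<in> ?S" using D(1-3) by simp
      have "mon_deg m = mon_deg (Poly_Mapping.update F 0 m) + Poly_Mapping.lookup m F"
        using arg_cong[OF D(4), of mon_deg] by (simp add: mon_deg_add)
      then show "(case (low m F, Poly_Mapping.update F 0 m, Poly_Mapping.lookup m F) of
         (G, m, d) \<Rightarrow> monom (1::rat) (mon_deg m) * monom 1 d) = monom 1 (mon_deg m)"
        by (simp add: mult_monom)
    next
      fix x assume x: "x \<in> ?S"
      obtain G m d where Gmd: "x = (G, m, d)" by (cases x)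
      have g: "G \<subset> F" "m \<in> FY_with_top G" "d \<in> {1..<card F - card G}" using x Gmd by auto
      note D = FY_with_top_extend[OF less.prems g]
      show "(low (?i x) F, Poly_Mapping.update F 0 (?i x), Poly_Mapping.lookup (?i x) F) = x"
        unfolding Gmd using D(2-4) by simp
      show "?i x \<in> FY_with_top F" unfolding Gmd using D(1) by simp
    qed
    also have "\<dots> = (\<Sum>G | G \<subset> F. \<Sum>(m, d)\<in>?T G. monom 1 (mon_deg m) * monom 1 d)"
      by (rule sum.Sigma[symmetric]) (use finS IH in auto)
    also have "\<dots> = (\<Sum>G | G \<subset> F. Der (card G) * (\<Sum>d=1..<card F - card G. monom 1 d))"
    proof (rule sum.cong[OF refl])
      fix G assume "G \<in> {G. G \<subset> F}"
      then have "G \<subset> F" by simp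
      then show "(\<Sum>(m, d)\<in>?T G. monom (1::rat) (mon_deg m) * monom 1 d) =
         Der (card G) * (\<Sum>d=1..<card F - card G. monom 1 d)"
        unfolding IH(2)[OF \<open>G \<subset> F\<close>, symmetric] by (simp add: sum_product sum.cartesian_product)
    qed
    also have "\<dots> = (\<Sum>l<card F. of_nat (card F choose l) * (Der l * (\<Sum>d=1..<card F - l. monom 1 d)))"
      by (rule sum_psubsets_by_card[OF less.prems])
    also have "\<dots> = Der (card F)"
      using False less.prems by (subst (2) Der.simps) (simp add: mult.assoc)
    finally show ?thesis using fin by blast
  qed
qed

section \<open>Both counts over all flats of the uniform matroid\<close>

context uniform_chow
begin

lemma V_iff: "F \<in> V \<longleftrightarrow> F \<subseteq> E \<and> F \<noteq> {} \<and> card F < k"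
  by (simp add: V_def)

lemma small_subset_finite: "F \<subseteq> E \<Longrightarrow> finite F"
  using finE finite_subset by blast

lemma Union_V_chain:
  assumes "C \<subseteq> V" "is_chain C" shows "\<Union>C \<subseteq> E \<and> card (\<Union>C) < k"
proof -
  have "finite C" using assms(1) finite_V finite_subset by blast
  then have "\<Union>C = {} \<or> \<Union>C \<in> V" using chain_Union_mem assms by blast
  then show ?thesis
  proof
    assume e: "\<Union>C = {}"
    show ?thesis unfolding e using k1 by simp
  qed (simp add: V_iff)
qed

lemma card_V_chain:
  assumes "C \<subseteq> V" "is_chain C" shows "card C < k"
proof -
  have "{} \<notin> C" using assms(1) V_iff by blast
  then have "C \<in> chains_with_top (\<Union>C)" using assms(2) by (simp add: chains_with_top_def)
  then have "card C \<le> card (\<Union>C)"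
    using Union_V_chain[OF assms] by (intro card_chain_le small_subset_finite) simp_all
  then show ?thesis using Union_V_chain[OF assms] by simp
qed

lemma V_subset_of_top:
  assumes "\<Union>C \<subseteq> E" "card (\<Union>C) < k" "{} \<notin> C" shows "C \<subseteq> V"
proof
  fix H assume H: "H \<in> C"
  have "card H \<le> card (\<Union>C)" using H small_subset_finite[OF assms(1)] by (intro card_mono) auto
  moreover have "H \<noteq> {}" using H assms(3) by blast
  ultimately show "H \<in> V" using H assms by (auto simp: V_iff)
qed

lemma sum_V_chains:
  "(\<Sum>C | C \<subseteq> V \<and> is_chain C. [:-1, 1:] ^ (k - 1 - card C)) =
    (\<Sum>l<k. of_nat (card E choose l) * Eul l * [:-1, 1:] ^ (k - l - 1))"
proof -
  let ?y = "[:-1, 1:] :: rat poly"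
  let ?T = "{F. F \<subseteq> E \<and> card F < k}"
  have "(\<Sum>C | C \<subseteq> V \<and> is_chain C. ?y ^ (k - 1 - card C)) =
    (\<Sum>F\<in>?T. \<Sum>C\<in>{C\<in>{C. C \<subseteq> V \<and> is_chain C}. \<Union>C = F}. ?y ^ (k - 1 - card C))"
  proof (rule sum.group[symmetric])
    show "finite {C. C \<subseteq> V \<and> is_chain C}" using finite_V by simp
    show "finite ?T" using finE by simp
    show "Union ` {C. C \<subseteq> V \<and> is_chain C} \<subseteq> ?T" using Union_V_chain by blast
  qed
  also have "\<dots> = (\<Sum>F\<in>?T. Eul (card F) * ?y ^ (k - card F - 1))"
  proof (rule sum.cong[OF refl])
    fix F assume F: "F \<in> ?T"
    then have finF: "finite F" using small_subset_finite by blast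
    have "{C\<in>{C. C \<subseteq> V \<and> is_chain C}. \<Union>C = F} = chains_with_top F"
      using F V_subset_of_top by (auto simp: chains_with_top_def V_iff)
    then have "(\<Sum>C\<in>{C\<in>{C. C \<subseteq> V \<and> is_chain C}. \<Union>C = F}. ?y ^ (k - 1 - card C)) =
      (\<Sum>C\<in>chains_with_top F. ?y ^ (card F - card C) * ?y ^ (k - card F - 1))"
    proof (intro sum.cong)
      fix C assume "C \<in> chains_with_top F"
      then have "k - 1 - card C = (card F - card C) + (k - card F - 1)"
        using card_chain_le[OF finF] F by fastforce
      then show "?y ^ (k - 1 - card C) = ?y ^ (card F - card C) * ?y ^ (k - card F - 1)"
        by (simp only: power_add)
    qed simp
    then show "(\<Sum>C\<in>{C\<in>{C. C \<subseteq> V \<and> is_chain C}. \<Union>C = F}. ?y ^ (k - 1 - card C)) = Eul (card F) * ?y ^ (k - card F - 1)"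
      unfolding sum_distrib_right[symmetric] sum_chains_with_top[OF finF] .
  qed
  also have "\<dots> = (\<Sum>l<k. of_nat (card E choose l) * (Eul l * ?y ^ (k - l - 1)))"
    by (rule sum_subsets_by_card[OF finE])
  finally show ?thesis by (simp add: mult.assoc)
qed

text \<open>Once the top is small, the support lies in \<open>V\<close> automatically; {} is
  excluded because its gap inequality would put a natural number below 0.\<close>

lemma FY_fiber:
  assumes "F \<subseteq> E" "card F < k"
  shows "{m\<in>FY. \<Union>(Poly_Mapping.keys m) = F} = FY_with_top F"
proof (rule set_eqI)
  fix m
  have sub: "Poly_Mapping.keys m \<subseteq> V" if m: "m \<in> FY_with_top F"
  proof (rule V_subset_of_top)
    note m' = m[unfolded FY_with_top_def mem_Collect_eq]
    have top: "\<Union>(Poly_Mapping.keys m) = F" by (rule m'[THEN conjunct2, THEN conjunct1])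
    show "\<Union>(Poly_Mapping.keys m) \<subseteq> E" "card (\<Union>(Poly_Mapping.keys m)) < k"
      unfolding top using assms by simp_all
    show "{} \<notin> Poly_Mapping.keys m"
    proof
      assume "{} \<in> Poly_Mapping.keys m"
      with m'[THEN conjunct2, THEN conjunct2]
      have "Poly_Mapping.lookup m {} + card (low m {}) < card ({} :: 'a set)" by (rule bspec)
      then show False by simp
    qed
  qed
  have "((P \<and> Q \<and> R) \<and> T) = (Q \<and> T \<and> R)" if "Q \<and> T \<and> R \<Longrightarrow> P" for P Q R T
    using that by blast
  from this[OF sub[unfolded FY_with_top_def mem_Collect_eq]]
  show "m \<in> {m\<in>FY. \<Union>(Poly_Mapping.keys m) = F} \<longleftrightarrow> m \<in> FY_with_top F"
    unfolding FY_def FY_with_top_def mem_Collect_eq .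
qed

lemma FY_top: "m \<in> FY \<Longrightarrow> \<Union>(Poly_Mapping.keys m) \<subseteq> E \<and> card (\<Union>(Poly_Mapping.keys m)) < k"
  by (rule Union_V_chain) (auto simp: FY_def)

lemma finite_FY: "finite FY"
proof -
  have "FY \<subseteq> (\<Union>F\<in>{F. F \<subseteq> E \<and> card F < k}. FY_with_top F)"
  proof
    fix m assume m: "m \<in> FY"
    let ?F = "\<Union>(Poly_Mapping.keys m)"
    have F: "?F \<subseteq> E" "card ?F < k" using FY_top[OF m] by auto
    then have "m \<in> FY_with_top ?F" using m FY_fiber[OF F] by auto
    then show "m \<in> (\<Union>F\<in>{F. F \<subseteq> E \<and> card F < k}. FY_with_top F)" using F by (intro UN_I[of ?F]) simp_all
  qed
  then show ?thesis
    by (rule finite_subset) (use finE sum_FY_with_top small_subset_finite in auto)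
qed

definition hilb :: "rat poly" where
  "hilb = (\<Sum>l<k. of_nat (card E choose l) * Der l * Qp (k - l))"

lemma sum_FY: "(\<Sum>m\<in>FY. monom 1 (mon_deg m) * Qp (k - card (\<Union>(Poly_Mapping.keys m)))) = hilb"
proof -
  let ?T = "{F. F \<subseteq> E \<and> card F < k}"
  have "(\<Sum>m\<in>FY. monom 1 (mon_deg m) * Qp (k - card (\<Union>(Poly_Mapping.keys m)))) =
    (\<Sum>F\<in>?T. \<Sum>m\<in>{m\<in>FY. \<Union>(Poly_Mapping.keys m) = F}. monom 1 (mon_deg m) * Qp (k - card (\<Union>(Poly_Mapping.keys m))))"
  proof (rule sum.group[symmetric])
    show "(\<lambda>m. \<Union>(Poly_Mapping.keys m)) ` FY \<subseteq> ?T" using FY_top by (intro image_subsetI) simp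
  qed (simp_all add: finite_FY finE)
  also have "\<dots> = (\<Sum>F\<in>?T. Der (card F) * Qp (k - card F))"
  proof (rule sum.cong[OF refl])
    fix F assume F: "F \<in> ?T"
    have "(\<Sum>m\<in>{m\<in>FY. \<Union>(Poly_Mapping.keys m) = F}. monom 1 (mon_deg m) * Qp (k - card (\<Union>(Poly_Mapping.keys m))))
      = (\<Sum>m\<in>FY_with_top F. monom 1 (mon_deg m) * Qp (k - card F))"
      by (rule sum.cong) (use F FY_fiber in \<open>auto simp: FY_with_top_def\<close>)
    then show "(\<Sum>m\<in>{m\<in>FY. \<Union>(Poly_Mapping.keys m) = F}. monom 1 (mon_deg m) * Qp (k - card (\<Union>(Poly_Mapping.keys m))))
      = Der (card F) * Qp (k - card F)"
      unfolding sum_distrib_right[symmetric] using sum_FY_with_top[of F] F small_subset_finite by simp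
  qed
  also have "\<dots> = (\<Sum>l<k. of_nat (card E choose l) * (Der l * Qp (k - l)))"
    by (rule sum_subsets_by_card[OF finE])
  finally show ?thesis by (simp add: hilb_def mult.assoc)
qed

lemma card_FYE: "of_nat (card (FYE j)) = coeff hilb j"
proof -
  let ?top = "\<lambda>m. card (\<Union>(Poly_Mapping.keys m))"
  let ?S = "Sigma FY (\<lambda>m. {..<k - ?top m})"
  have "hilb = (\<Sum>m\<in>FY. \<Sum>e<k - ?top m. monom 1 (mon_deg m + e))"
    unfolding sum_FY[symmetric] Qp_def by (simp add: sum_distrib_left mult_monom)
  also have "\<dots> = (\<Sum>(m, e)\<in>?S. monom 1 (mon_deg m + e))"
    by (rule sum.Sigma) (use finite_FY in auto)
  finally have "coeff hilb j = (\<Sum>(m, e)\<in>?S. if mon_deg m + e = j then 1 else 0)"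
    by (simp add: coeff_sum split_def)
  also have "\<dots> = (\<Sum>x\<in>{x\<in>?S. mon_deg (fst x) + snd x = j}. 1)"
    unfolding split_def using finite_FY by (intro sum.inter_filter[symmetric]) auto
  also have "{x\<in>?S. mon_deg (fst x) + snd x = j} = FYE j"
    by (auto simp: FYE_def)
  finally show ?thesis by simp
qed

end

subsection \<open>The Chow ring and the Bergman complex of a uniform matroid\<close>

context vector_space
begin

text \<open>A basis of U together with the images of A is a basis of H. The finite spanning set
  makes these dimensions finite, so the truncating subtraction is the true codimension. Coefficients
  are indexed by A, hence injectivity of f has to be derived.\<close>

lemma dim_diff_eq_card:
  assumes "subspace U" "U \<subseteq> H" "subspace H" "finite M" "H \<subseteq> span M" "finite A" "f ` A \<subseteq> H"
    and spanning: "\<And>p. p \<in> H \<Longrightarrow> \<exists>c. p - (\<Sum>a\<in>A. c a *s f a) \<in> U"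
    and independent_mod: "\<And>c. (\<Sum>a\<in>A. c a *s f a) \<in> U \<Longrightarrow> \<forall>a\<in>A. c a = 0"
  shows "dim H - dim U = card A"
proof -
  obtain B where B: "B \<subseteq> U" "independent B" "U \<subseteq> span B" "card B = dim U"
    using basis_exists[of U] by blast
  have finB: "finite B" using independent_span_bound[OF assms(4) B(2)] B(1) assms by blast
  have ind: "(\<Sum>x\<in>A. (if x = a then t else 0) *s f x) = t *s f a" if "a \<in> A" for a t
  proof -
    have "(\<Sum>x\<in>A. (if x = a then t else 0) *s f x) = (\<Sum>x\<in>A. if x = a then t *s f a else 0)"
      by (rule sum.cong) auto
    then show ?thesis using that assms(6) by simp
  qed
  have inj: "inj_on f A"
  proof (rule inj_onI, rule ccontr)
    fix a b assume ab: "a \<in> A" "b \<in> A" "f a = f b" "a \<noteq> b"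
    \<comment> \<open>Two indices with the same image would give a relation with coefficients 1 and
      -1.\<close>
    have "(\<Sum>x\<in>A. ((if x = a then 1 else 0) + (if x = b then -1 else 0)) *s f x) = 1 *s f a + (-1) *s f b"
      unfolding scale_left_distrib sum.distrib using ind ab by simp
    also have "\<dots> \<in> U" using ab subspace_0[OF assms(1)] by simp
    finally have "\<forall>x\<in>A. (if x = a then 1 else 0) + (if x = b then -1 else (0::'a)) = 0"
      by (rule independent_mod)
    then show False using ab by auto
  qed
  have notU: "f a \<notin> U" if "a \<in> A" for a
  proof
    assume "f a \<in> U"
    then have "(\<Sum>x\<in>A. (if x = a then 1 else 0) *s f x) \<in> U" using ind[OF that, of 1] by simp
    then have "\<forall>x\<in>A. (if x = a then 1 else (0::'a)) = 0" by (rule independent_mod)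
    then show False using that by auto
  qed
  have disj: "B \<inter> f ` A = {}" using notU B(1) by blast
  have "independent (B \<union> f ` A)"
  proof
    assume "dependent (B \<union> f ` A)"
    then obtain u where u: "\<exists>v\<in>B \<union> f ` A. u v \<noteq> 0" "(\<Sum>v\<in>B \<union> f ` A. u v *s v) = 0"
      using dependent_finite[of "B \<union> f ` A"] finB assms(6) by auto
    have "(\<Sum>v\<in>B \<union> f ` A. u v *s v) = (\<Sum>v\<in>B. u v *s v) + (\<Sum>a\<in>A. u (f a) *s f a)"
      using finB assms(6) disj by (subst sum.union_disjoint) (auto simp: sum.reindex[OF inj])
    then have eq: "(\<Sum>a\<in>A. u (f a) *s f a) = - (\<Sum>v\<in>B. u v *s v)"
      using u(2) by (simp add: eq_neg_iff_add_eq_0 add.commute)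
    also have "\<dots> \<in> U"
      by (intro subspace_neg subspace_sum subspace_scale assms(1)) (use B(1) in auto)
    finally have z: "\<forall>a\<in>A. u (f a) = 0" by (rule independent_mod)
    then have "(\<Sum>v\<in>B. u v *s v) = 0" using eq by simp
    then have "\<forall>v\<in>B. u v = 0" using B(2) dependent_finite[OF finB] by blast
    then show False using z u(1) by auto
  qed
  moreover have "H \<subseteq> span (B \<union> f ` A)"
  proof
    fix p assume "p \<in> H"
    then obtain c where "p - (\<Sum>a\<in>A. c a *s f a) \<in> U" using spanning by blast
    then have "p - (\<Sum>a\<in>A. c a *s f a) \<in> span (B \<union> f ` A)" using B(3) span_mono[of B "B \<union> f ` A"] by blast
    moreover have "(\<Sum>a\<in>A. c a *s f a) \<in> span (B \<union> f ` A)"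
      by (intro span_sum span_scale span_base) auto
    ultimately have "(p - (\<Sum>a\<in>A. c a *s f a)) + (\<Sum>a\<in>A. c a *s f a) \<in> span (B \<union> f ` A)" by (rule span_add)
    then show "p \<in> span (B \<union> f ` A)" by simp
  qed
  ultimately have "dim H = card (B \<union> f ` A)"
    using B(1) assms(2,7) by (intro dim_unique[OF _ _ _ refl]) auto
  also have "\<dots> = dim U + card A"
    using finB assms(6) disj B(4) by (simp add: card_Un_disjoint card_image[OF inj])
  finally show ?thesis by simp
qed

end

lemma homog_part_diff:
  "p \<in> homog_part W j \<Longrightarrow> q \<in> homog_part W j \<Longrightarrow> p - q \<in> homog_part W j"
  using homog_part_add[of p W j "qscale (-1) q"] homog_part_qscale[of q W j "-1"]
  by (simp add: qscale_eq single_uminus)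

interpretation qvs: vector_space "qscale :: rat \<Rightarrow> 'v mpoly \<Rightarrow> 'v mpoly"
  by (rule qscale_vector_space)

context uniform_chow
begin

lemma lin_homog: "lin i \<in> homog_part V 1"
  unfolding lin_def by (intro homog_part_sum homog_part_mvar) simp

lemma fy_elem_homog:
  assumes "x \<in> FYE j" shows "fy_elem x \<in> homog_part V j"
proof -
  obtain m e where x: "x = (m, e)" by (cases x)
  then have m: "Poly_Mapping.keys m \<subseteq> V" "mon_deg m + e = j" using assms FY_D(1) by (auto simp: FYE_def)
  have "Poly_Mapping.single m 1 * lin i0 ^ e \<in> homog_part V (mon_deg m + 1 * e)"
    by (intro homog_part_mult homog_part_power lin_homog homog_part_single m) simp
  then show ?thesis using x m by (simp add: fy_elem_def)
qed

lemma dim_homog_mod_ideal: "qvs.dim (homog_part V j) - qvs.dim (homog_part V j \<inter> I) = card (FYE j)"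
proof (rule qvs.dim_diff_eq_card[where f=fy_elem])
  let ?M = "(\<lambda>m. Poly_Mapping.single m 1) ` {m. Poly_Mapping.keys m \<subseteq> V \<and> mon_deg m \<le> j}"
  show "qvs.subspace (homog_part V j \<inter> I)"
    by (auto simp: qvs.subspace_def homog_part_0 homog_part_add homog_part_qscale
       intro: ideal_in.intros ideal_in_qscale)
  show "qvs.subspace (homog_part V j)"
    by (auto simp: qvs.subspace_def homog_part_0 homog_part_add homog_part_qscale)
  show "finite ?M" by (intro finite_imageI finite_monomials)
  show "homog_part V j \<subseteq> qvs.span ?M"
  proof
    fix p :: "'a set mpoly" assume p: "p \<in> homog_part V j"
    have "(\<Sum>m\<in>Poly_Mapping.keys p. qscale (Poly_Mapping.lookup p m) (Poly_Mapping.single m 1)) \<in> qvs.span ?M"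
      by (intro qvs.span_sum qvs.span_scale qvs.span_base)
         (use p in \<open>auto simp: homog_part_def polys_in_def\<close>)
    also have "(\<Sum>m\<in>Poly_Mapping.keys p. qscale (Poly_Mapping.lookup p m) (Poly_Mapping.single m 1)) = p"
      by (subst (3) mpoly_eq_sum_single[of p]) (simp add: qscale_eq mult_single)
    finally show "p \<in> qvs.span ?M" .
  qed
  show "finite (FYE j)" by (rule finite_FYE)
  show "fy_elem ` FYE j \<subseteq> homog_part V j" using fy_elem_homog by blast
  fix p :: "'a set mpoly" assume p: "p \<in> homog_part V j"
  then obtain c where c: "p - (\<Sum>x\<in>FYE j. qscale (c x) (fy_elem x)) \<in> I"
    using homog_reducible unfolding reducible_def by blast
  have "p - (\<Sum>x\<in>FYE j. qscale (c x) (fy_elem x)) \<in> homog_part V j"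
    by (intro homog_part_diff p homog_part_sum homog_part_qscale fy_elem_homog)
  then show "\<exists>c. p - (\<Sum>x\<in>FYE j. qscale (c x) (fy_elem x)) \<in> homog_part V j \<inter> I" using c by blast
next
  fix c assume "(\<Sum>x\<in>FYE j. qscale (c x) (fy_elem x)) \<in> homog_part V j \<inter> I"
  then show "\<forall>x\<in>FYE j. c x = 0" using fy_elem_independent[of c j] by simp
qed auto

end

section \<open>Rank, flats and both invariants of the uniform matroid\<close>

lemma mrank_uniform:
  assumes "k \<le> n" "A \<subseteq> {1..n}"
  shows "mrank (uniform_bases k n) A = min (card A) k"
proof -
  have finA: "finite A" using assms finite_subset by blast
  have "\<exists>B. B \<subseteq> {1..n} \<and> card B = k \<and> card (A \<inter> B) = min (card A) k"
  proof (cases "card A \<le> k")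
    case True
    have "k - card A \<le> card ({1..n} - A)" using assms finA by (simp add: card_Diff_subset)
    then obtain C where C: "C \<subseteq> {1..n} - A" "card C = k - card A" "finite C"
      using obtain_subset_with_card_n by metis
    have "card (A \<union> C) = k" using C True finA by (subst card_Un_disjoint) auto
    moreover have "A \<inter> (A \<union> C) = A" by blast
    ultimately show ?thesis using C True assms by (intro exI[of _ "A \<union> C"]) auto
  next
    case False
    then obtain B where B: "B \<subseteq> A" "card B = k" using obtain_subset_with_card_n[of k A] by auto
    moreover have "A \<inter> B = B" using B by blast
    ultimately show ?thesis using assms False by (intro exI[of _ B]) auto
  qed
  then obtain B where "B \<in> uniform_bases k n" "card (A \<inter> B) = min (card A) k"
    by (auto simp: uniform_bases_def)
  then have "min (card A) k \<in> (\<lambda>B. card (A \<inter> B)) ` uniform_bases k n"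
    by (intro image_eqI[of _ _ B]) simp_all
  moreover have "card (A \<inter> B) \<le> min (card A) k" if "B \<in> uniform_bases k n" for B
    using that finA by (auto simp: uniform_bases_def intro!: card_mono intro: finite_subset)
  moreover have "finite (uniform_bases k n)"
    by (rule finite_subset[of _ "Pow {1..n}"]) (auto simp: uniform_bases_def)
  ultimately show ?thesis
    unfolding mrank_def by (intro Max_eqI) auto
qed

lemma flats_uniform:
  assumes "k \<le> n"
  shows "flats {1..n} (uniform_bases k n) = {F. F \<subseteq> {1..n} \<and> (card F < k \<or> F = {1..n})}"
proof (rule set_eqI)
  fix F
  have "(\<forall>e\<in>{1..n} - F. mrank (uniform_bases k n) F < mrank (uniform_bases k n) (insert e F)) \<longleftrightarrow>
      (card F < k \<or> F = {1..n})" if F: "F \<subseteq> {1..n}"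
  proof -
    have "mrank (uniform_bases k n) F < mrank (uniform_bases k n) (insert e F) \<longleftrightarrow> card F < k"
      if "e \<in> {1..n} - F" for e
    proof -
      have "finite F" using F finite_subset by blast
      moreover have "insert e F \<subseteq> {1..n}" using that F by blast
      ultimately show ?thesis
        unfolding mrank_uniform[OF assms F] mrank_uniform[OF assms \<open>insert e F \<subseteq> _\<close>] using that by auto
    qed
    then show ?thesis using F by auto
  qed
  then show "F \<in> flats {1..n} (uniform_bases k n) \<longleftrightarrow> F \<in> {F. F \<subseteq> {1..n} \<and> (card F < k \<or> F = {1..n})}"
    unfolding flats_def by blast
qed

lemma uniform_chow_interval: "1 \<le> k \<Longrightarrow> k \<le> n \<Longrightarrow> uniform_chow {1..n} k"
  by unfold_locales auto

lemma proper_flats_uniform: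
  assumes "1 \<le> k" "k \<le> n"
  shows "proper_flats {1..n} (uniform_bases k n) = uniform_chow.V {1..n} k"
  unfolding proper_flats_def flats_uniform[OF assms(2)] uniform_chow.V_def[OF uniform_chow_interval[OF assms]]
  using assms by auto

lemma chow_hilbert_uniform:
  assumes "1 \<le> k" "k \<le> n"
  shows "chow_hilbert {1..n} (uniform_bases k n) = fps_of_poly (uniform_chow.hilb {1..n} k)"
proof -
  interpret uniform_chow "{1..n}" k by (rule uniform_chow_interval[OF assms])
  have gens: "chow_gens {1..n} (uniform_bases k n) = gens"
    unfolding chow_gens_def gens_def lin_def proper_flats_uniform[OF assms] ..
  have "of_nat (chow_dim {1..n} (uniform_bases k n) j) = coeff hilb j" for j
    unfolding chow_dim_def gens proper_flats_uniform[OF assms] dim_homog_mod_ideal card_FYE ..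
  then show ?thesis unfolding chow_hilbert_def by (intro fps_ext) simp
qed

lemma pcompose_monom: "pcompose (monom c i) p = smult c (p ^ i)"
  by (induction i) (simp_all add: monom_0 pcompose_const monom_Suc pcompose_pCons mult_smult_right)

lemma bergman_h_poly_uniform:
  assumes "1 \<le> k" "k \<le> n"
  shows "bergman_h_poly {1..n} (uniform_bases k n) =
    (\<Sum>l<k. of_nat (n choose l) * Eul l * [:-1, 1:] ^ (k - l - 1))"
proof -
  interpret uniform_chow "{1..n}" k by (rule uniform_chow_interval[OF assms])
  let ?C = "{C. C \<subseteq> V \<and> is_chain C}"
  have rank: "mrank (uniform_bases k n) {1..n} = k" using mrank_uniform[OF assms(2), of "{1..n}"] assms by simp
  have faces: "bergman_faces {1..n} (uniform_bases k n) i = card {C\<in>?C. card C = i}" for i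
  proof -
    have "finite C" if "C \<subseteq> V" for C using that finite_V by (rule finite_subset)
    then show ?thesis unfolding bergman_faces_def proper_flats_uniform[OF assms]
      by (intro arg_cong[of _ _ card]) blast
  qed
  have "bergman_h_poly {1..n} (uniform_bases k n) =
     (\<Sum>i<k. of_nat (card {C\<in>?C. card C = i}) * [:-1, 1:] ^ (k - 1 - i))"
    unfolding bergman_h_poly_def bergman_f_poly_def rank Let_def faces pcompose_sum pcompose_monom
    by (simp add: of_nat_poly)
  also have "\<dots> = (\<Sum>i<k. \<Sum>C\<in>{C\<in>?C. card C = i}. [:-1, 1:] ^ (k - 1 - card C))"
    by (intro sum.cong) auto
  also have "\<dots> = (\<Sum>C\<in>?C. [:-1, 1:] ^ (k - 1 - card C))"
  proof (rule sum.group)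
    show "finite ?C" using finite_V by simp
    show "card ` ?C \<subseteq> {..<k}" using card_V_chain by blast
  qed simp
  also have "\<dots> = (\<Sum>l<k. of_nat (n choose l) * Eul l * [:-1, 1:] ^ (k - l - 1))"
    using sum_V_chains by simp
  finally show ?thesis .
qed

text \<open>The upper index is negative only for i = k = n, where \<open>gchoose\<close> with lower
  index 0 gives 1; elsewhere it is an ordinary binomial coefficient. The Hilbert series are power
  series by definition, and \<open>hilb\<close> is the polynomial behind them.\<close>

theorem theoremA3:
  fixes k n :: nat
  assumes "1 \<le> k" and "k \<le> n"
  shows "fps_of_poly (bergman_h_poly {1..n} (uniform_bases k n)) =
    (\<Sum>i = 1..k. fps_const ((of_int (int n - int i - 1) :: rat) gchoose (k - i))
                  * chow_hilbert {1..n} (uniform_bases i n))"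
proof -
  have "bergman_h_poly {1..n} (uniform_bases k n) =
    (\<Sum>i=1..k. smult ((of_nat n - of_nat i - 1) gchoose (k - i)) (uniform_chow.hilb {1..n} i))"
    unfolding bergman_h_poly_uniform[OF assms] Eul_sum_identity[OF assms(2)]
  proof (rule sum.cong[OF refl])
    fix i assume "i \<in> {1..k}"
    then have "uniform_chow {1..n} i" using assms by (intro uniform_chow_interval) auto
    then show "smult ((of_nat n - of_nat i - 1) gchoose (k - i)) (\<Sum>l<i. of_nat (n choose l) * Der l * Qp (i - l)) =
      smult ((of_nat n - of_nat i - 1) gchoose (k - i)) (uniform_chow.hilb {1..n} i)"
      by (simp add: uniform_chow.hilb_def del: One_nat_def)
  qed
  also have "fps_of_poly \<dots> = (\<Sum>i=1..k. fps_const ((of_nat n - of_nat i - 1) gchoose (k - i))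
       * fps_of_poly (uniform_chow.hilb {1..n} i))"
    by (simp add: fps_of_poly_sum fps_of_poly_smult)
  also have "\<dots> = (\<Sum>i = 1..k. fps_const ((of_int (int n - int i - 1) :: rat) gchoose (k - i))
                  * chow_hilbert {1..n} (uniform_bases i n))"
    by (rule sum.cong) (use assms in \<open>simp_all add: chow_hilbert_uniform del: One_nat_def\<close>)
  finally show ?thesis .
qed

end
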